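(* There exist a compact mean convex domain $M \subset \mathbb{R}^3$ (with the Euclidean metric) and a simple closed curve $\Gamma \subset \partial M$ such that the area minimizing disk in $\mathbb{R}^3$ with boundary $\Gamma$ is not embedded; that is, no disk $D$ in $\mathbb{R}^3$ with $\partial D = \Gamma$ that has the smallest area among all disks in $\mathbb{R}^3$ with boundary $\Gamma$ is embedded.
   Context: Disks are maps of the closed unit disk, not assumed to be embedded, whose restriction to the boundary circle is a (monotone) parametrization of the given simple closed curve. An area minimizing disk in $\mathbb{R}^3$ is a disk which has the smallest area among all disks in $\mathbb{R}^3$ with the same boundary (competitors are not required to lie in $M$). A compact Riemannian $3$-manifold $M$ with boundary is called mean convex if: (1) $\partial M$ is piecewise smooth; (2) each smooth subsurface of $\partial M$ has nonnegative mean curvature with respect to the inward normal; (3) there is a Riemannian manifold $N$ such that $M$ is isometric to a submanifold of $N$ and each smooth subsurface $S$ of $\partial M$ extends to a smooth embedded surface $S'$ in $N$ with $S' \cap M = S$. A mean convex domain in $\mathbb{R}^3$ is a compact domain which, with the Euclidean metric, is mean convex in this sense. *)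

theory Defs
  imports "HOL-Analysis.Analysis"
begin

primrec Ck_on :: "nat \<Rightarrow> 'a::euclidean_space set \<Rightarrow> ('a \<Rightarrow> 'b::real_normed_vector) \<Rightarrow> bool" where
  "Ck_on 0 U f \<longleftrightarrow> continuous_on U f"
| "Ck_on (Suc k) U f \<longleftrightarrow>
     f differentiable_on U \<and> (\<forall>b\<in>Basis. Ck_on k U (\<lambda>x. frechet_derivative f (at x) b))"

(* Meant for open U only: the derivatives are taken in the ambient space. *)
definition smooth_on :: "'a::euclidean_space set \<Rightarrow> ('a \<Rightarrow> 'b::real_normed_vector) \<Rightarrow> bool" where
  "smooth_on U f \<longleftrightarrow> (\<forall>k. Ck_on k U f)"

definition smooth_arc :: "(real \<Rightarrow> real^3) \<Rightarrow> bool" where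
  "smooth_arc g \<longleftrightarrow> arc g \<and>
     (\<exists>I. open I \<and> {0..1} \<subseteq> I \<and> smooth_on I g) \<and>
     (\<forall>t\<in>{0..1}. vector_derivative g (at t) \<noteq> 0)"

(* Embedded surfaces without boundary, not necessarily closed as subsets of space. *)
definition smooth_surface :: "(real^3) set \<Rightarrow> bool" where
  "smooth_surface S \<longleftrightarrow>
     (\<forall>p\<in>S. \<exists>U (V::(real^2) set) \<phi> \<psi>.
        open U \<and> p \<in> U \<and> open V \<and> homeomorphism V (S \<inter> U) \<phi> \<psi> \<and>
        smooth_on V \<phi> \<and> (\<forall>x\<in>V. inj (frechet_derivative \<phi> (at x))))"

definition tangent_vectors :: "(real^3) set \<Rightarrow> real^3 \<Rightarrow> (real^3) set" where
  "tangent_vectors S p =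
     {v. \<exists>\<gamma> \<epsilon>. \<epsilon> > 0 \<and> (\<forall>t::real. \<bar>t\<bar> < \<epsilon> \<longrightarrow> \<gamma> t \<in> S) \<and> \<gamma> 0 = p \<and>
              (\<gamma> has_vector_derivative v) (at 0)}"

(* The unit normal field of the part S \<inter> U of the boundary of M pointing into M,
   together with a smooth extension to the open set U. *)
definition inward_unit_normal ::
  "(real^3) set \<Rightarrow> (real^3) set \<Rightarrow> (real^3) set \<Rightarrow> (real^3 \<Rightarrow> real^3) \<Rightarrow> bool" where
  "inward_unit_normal M S U \<nu> \<longleftrightarrow> open U \<and> smooth_on U \<nu> \<and>
     (\<forall>x\<in>S \<inter> U. norm (\<nu> x) = 1 \<and>
        (\<forall>v\<in>tangent_vectors S x. \<nu> x \<bullet> v = 0) \<and>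
        (\<exists>\<epsilon>>0. \<forall>t. 0 < t \<and> t < \<epsilon> \<longrightarrow> x + t *\<^sub>R \<nu> x \<in> interior M))"

(* Half the trace of the shape operator -d\<nu> over the tangent plane, which is the orthogonal
   complement of the unit vector \<nu> p; the value does not depend on the extension of \<nu> off the
   surface.  The unit sphere has mean curvature 1 with respect to its inward normal. *)
definition mean_curvature :: "(real^3 \<Rightarrow> real^3) \<Rightarrow> real^3 \<Rightarrow> real" where
  "mean_curvature \<nu> p =
     - (1/2) * ((\<Sum>b\<in>Basis. frechet_derivative \<nu> (at p) b \<bullet> b)
                - frechet_derivative \<nu> (at p) (\<nu> p) \<bullet> \<nu> p)"

definition locally_modelled_on ::
  "'a::topological_space set \<Rightarrow> 'b::topological_space set \<Rightarrow> bool" where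
  "locally_modelled_on X H \<longleftrightarrow>
     (\<forall>p\<in>X. \<exists>V W. openin (top_of_set X) V \<and> p \<in> V \<and> openin (top_of_set H) W \<and> V homeomorphic W)"

(* By invariance of domain the manifold boundary of M is its frontier. *)
definition compact_domain :: "(real^3) set \<Rightarrow> bool" where
  "compact_domain M \<longleftrightarrow> compact M \<and> interior M \<noteq> {} \<and> connected (interior M) \<and>
     closure (interior M) = M \<and> locally_modelled_on M {x::real^3. 0 \<le> x $ 3}"

(* \<F> is the set of smooth pieces (faces) of the boundary and A the set of smooth edges along
   which they meet.  A smooth boundary component is a face without edges. *)
definition piecewise_smooth_boundary :: "(real^3) set \<Rightarrow> (real^3) set set \<Rightarrow> bool" where
  "piecewise_smooth_boundary M \<F> \<longleftrightarrow>
     finite \<F> \<and> \<Union>\<F> = frontier M \<and>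
     (\<forall>S\<in>\<F>. compact S \<and> connected S \<and> S \<noteq> {} \<and>
        locally_modelled_on S {x::real^2. 0 \<le> x $ 2} \<and>
        (\<exists>S'. smooth_surface S' \<and> S \<subseteq> S')) \<and>
     (\<forall>S\<in>\<F>. \<forall>T\<in>\<F>. S \<noteq> T \<longrightarrow>
        (top_of_set (frontier M) interior_of S) \<inter> (top_of_set (frontier M) interior_of T) = {}) \<and>
     (\<exists>A. finite A \<and> (\<forall>g\<in>A. smooth_arc g) \<and>
        (\<forall>g\<in>A. \<forall>h\<in>A. g \<noteq> h \<longrightarrow>
           path_image g \<inter> path_image h
             \<subseteq> {pathstart g, pathfinish g} \<inter> {pathstart h, pathfinish h}) \<and>
        (\<forall>S\<in>\<F>. \<exists>B\<subseteq>A. (top_of_set (frontier M) frontier_of S) = (\<Union>g\<in>B. path_image g)))"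

(* The inequality is imposed at the relative interior points of each face; at its edges it
   follows by continuity. *)
definition nonneg_mean_curvature :: "(real^3) set \<Rightarrow> (real^3) set \<Rightarrow> bool" where
  "nonneg_mean_curvature M S \<longleftrightarrow>
     (let S\<^sub>0 = top_of_set (frontier M) interior_of S in
      \<forall>p\<in>S\<^sub>0. \<exists>U \<nu>. p \<in> U \<and> inward_unit_normal M S\<^sub>0 U \<nu> \<and> 0 \<le> mean_curvature \<nu> p)"

(* The ambient manifold N is an open region of Euclidean space around M.  As S' has no boundary,
   it extends S across its edges. *)
definition mean_convex_domain :: "(real^3) set \<Rightarrow> bool" where
  "mean_convex_domain M \<longleftrightarrow> compact_domain M \<and>
     (\<exists>\<F>. piecewise_smooth_boundary M \<F> \<and>
        (\<forall>S\<in>\<F>. nonneg_mean_curvature M S) \<and>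
        (\<exists>N. open N \<and> M \<subseteq> N \<and>
           (\<forall>S\<in>\<F>. \<exists>S'\<subseteq>N. smooth_surface S' \<and> S' \<inter> M = S)))"

definition simple_closed_curve :: "'a::topological_space set \<Rightarrow> bool" where
  "simple_closed_curve \<Gamma> \<longleftrightarrow>
     (\<exists>c. simple_path c \<and> pathfinish c = pathstart c \<and> path_image c = \<Gamma>)"

(* Continuous disks that are locally Lipschitz inside: this includes piecewise smooth disks and
   the harmonic disks solving the Plateau problem.  A map of the circle onto a Jordan curve is a
   weakly monotone parametrization of it iff its fibres are connected. *)
definition disk_spanning :: "(real^3) set \<Rightarrow> (real^2 \<Rightarrow> real^3) \<Rightarrow> bool" where
  "disk_spanning \<Gamma> f \<longleftrightarrow>
     continuous_on (cball 0 1) f \<and>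
     (\<forall>K. compact K \<and> K \<subseteq> ball 0 1 \<longrightarrow> (\<exists>L. L-lipschitz_on K f)) \<and>
     f ` sphere 0 1 = \<Gamma> \<and>
     monotone_map (top_of_set (sphere 0 1)) (top_of_set \<Gamma>) f"

(* Area counted with multiplicity.  By Rademacher's theorem the points where f is not
   differentiable are negligible for the maps considered. *)
definition disk_area :: "(real^2 \<Rightarrow> real^3) \<Rightarrow> ennreal" where
  "disk_area f =
     (\<integral>\<^sup>+x\<in>{x \<in> ball 0 1. f differentiable (at x)}.
        ennreal (norm (cross3 (frechet_derivative f (at x) (axis 1 1))
                              (frechet_derivative f (at x) (axis 2 1)))) \<partial>lborel)"

definition area_minimizing_disk :: "(real^3) set \<Rightarrow> (real^2 \<Rightarrow> real^3) \<Rightarrow> bool" where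
  "area_minimizing_disk \<Gamma> f \<longleftrightarrow> disk_spanning \<Gamma> f \<and>
     (\<forall>g. disk_spanning \<Gamma> g \<longrightarrow> disk_area f \<le> disk_area g)"

definition embedded_disk :: "(real^2 \<Rightarrow> real^3) \<Rightarrow> bool" where
  "embedded_disk f \<longleftrightarrow> embedding_map (top_of_set (cball 0 1)) euclidean f"

end

theory Submission
  imports Defs "HOL-Computational_Algebra.Fundamental_Theorem_Algebra"
begin

text \<open>
  Rotating a circle of radius \<open>1\<close> about an axis at distance \<open>2\<close> from its centre gives a torus whose mean
  curvature with respect to the inward normal is \<open>1 - 1/\<rho> \<ge> 0\<close>, where \<open>\<rho> \<ge> 1\<close> is the distance to the
  axis; so the solid torus is mean convex.  Its boundary carries a trefoil knot, which bounds no
  embedded disk at all, however wild.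

  The last claim needs no approximation by tame disks.  The trefoil is \<open>{z\<^sup>2 = w\<^sup>3}\<close> for suitable
  continuous complex functions \<open>z, w\<close> on space, and on it \<open>(z, w) = (T\<^sup>3, T\<^sup>2)\<close> with \<open>T\<close> an injection into
  the unit circle.  Off the trefoil the cubic \<open>t\<^sup>3 - 3wt - 2z\<close> has three distinct roots, so along the
  interior of an embedded disk its roots are continuous functions.  Near the trefoil the cubic is close
  to \<open>(t - 2T)(t + T)\<^sup>2\<close>; let \<open>t\<close> be the root close to \<open>2T\<close> on a slightly smaller concentric circle.  One
  third of the derivative of the cubic at \<open>t\<close>, namely \<open>t\<^sup>2 - w\<close>, has no zero on the smaller disk, hence
  has a logarithm there, whereas on its boundary it is close to \<open>3T\<^sup>2\<close>.  So \<open>T\<close> has a logarithm along the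
  boundary circle, which embeds a circle into a line.
\<close>

section \<open>Smooth functions\<close>

text \<open>\<open>frechet_derivative\<close> is chosen from the derivative predicate, which at a
  point of an open set depends only on values inside the set. So both choices coincide, which feeds
  the induction on \<open>k\<close>.\<close>

lemma Ck_on_cong:
  assumes "open U" "\<And>x. x \<in> U \<Longrightarrow> f x = g x"
  shows "Ck_on k U f \<longleftrightarrow> Ck_on k U g"
  using assms(2)
proof (induction k arbitrary: f g)
  case 0
  then show ?case using continuous_on_cong[of U U f g] by simp
next
  case (Suc k)
  have "(f has_derivative D) (at x) \<longleftrightarrow> (g has_derivative D) (at x)" if "x \<in> U" for D x
    using has_derivative_transform_within_open[OF _ assms(1) that, of f D UNIV g]
      has_derivative_transform_within_open[OF _ assms(1) that, of g D UNIV f] Suc.prems by auto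
  then have "frechet_derivative f (at x) = frechet_derivative g (at x)"
    and "f differentiable at x \<longleftrightarrow> g differentiable at x" if "x \<in> U" for x
    using that by (simp_all add: frechet_derivative_def differentiable_def)
  moreover from this have "f differentiable_on U \<longleftrightarrow> g differentiable_on U"
    using assms(1) by (simp add: differentiable_on_eq_differentiable_at)
  ultimately show ?case
    using Suc.IH[of "\<lambda>x. frechet_derivative f (at x) _" "\<lambda>x. frechet_derivative g (at x) _"] by simp
qed

text \<open>Partial derivatives stay in \<open>F\<close>, so the induction on the order never leaves
  it. Smoothness is thus reduced to a single differentiation step for a well-chosen family.\<close>

lemma smooth_on_derivation_closed_family:
  assumes U: "open U" and F: "f \<in> F"
    and deriv: "\<And>f. f \<in> F \<Longrightarrow> \<exists>D. (\<forall>x\<in>U. (f has_derivative D x) (at x)) \<and> (\<forall>b\<in>Basis. (\<lambda>x. D x b) \<in> F)"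
  shows "smooth_on U f"
  unfolding smooth_on_def
proof
  show "Ck_on k U f" for k
    using F
  proof (induction k arbitrary: f)
    case (0 f)
    with deriv[of f] have "f differentiable_on U"
      by (meson U differentiable_def differentiable_on_eq_differentiable_at)
    then show ?case by (simp add: differentiable_imp_continuous_on)
  next
    case (Suc k f)
    obtain D where D: "\<And>x. x \<in> U \<Longrightarrow> (f has_derivative D x) (at x)" "\<And>b. b \<in> Basis \<Longrightarrow> (\<lambda>x. D x b) \<in> F"
      using deriv[OF Suc.prems] by blast
    then have "f differentiable_on U"
      by (meson U differentiable_def differentiable_on_eq_differentiable_at)
    moreover have "Ck_on k U (\<lambda>x. frechet_derivative f (at x) b)" if "b \<in> Basis" for b
    proof -
      have "frechet_derivative f (at x) b = D x b" if "x \<in> U" for x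
        using frechet_derivative_at[OF D(1)[OF that]] by simp
      then have "Ck_on k U (\<lambda>x. frechet_derivative f (at x) b) \<longleftrightarrow> Ck_on k U (\<lambda>x. D x b)"
        by (intro Ck_on_cong[OF U])
      then show ?thesis using Suc.IH[OF D(2)[OF that]] by simp
    qed
    ultimately show ?case by simp
  qed
qed

text \<open>Polynomial expressions in the generators \<open>G\<close>. They form the closed family
  in the smoothness proofs: by the Leibniz rule only the derivatives of the generators have to be
  examined.\<close>

inductive function_algebra :: "('a \<Rightarrow> real) set \<Rightarrow> ('a \<Rightarrow> real) \<Rightarrow> bool" for G where
  gen: "g \<in> G \<Longrightarrow> function_algebra G g"
| const: "function_algebra G (\<lambda>x. c)"
| add: "function_algebra G f \<Longrightarrow> function_algebra G g \<Longrightarrow> function_algebra G (\<lambda>x. f x + g x)"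
| mult: "function_algebra G f \<Longrightarrow> function_algebra G g \<Longrightarrow> function_algebra G (\<lambda>x. f x * g x)"

lemma function_algebra_derivation:
  fixes G :: "('a::euclidean_space \<Rightarrow> real) set"
  assumes G: "\<And>g. g \<in> G \<Longrightarrow> \<exists>D. (\<forall>x\<in>U. (g has_derivative D x) (at x)) \<and> (\<forall>b. function_algebra G (\<lambda>x. D x b))"
    and f: "function_algebra G f"
  shows "\<exists>D. (\<forall>x\<in>U. (f has_derivative D x) (at x)) \<and> (\<forall>b. function_algebra G (\<lambda>x. D x b))"
  using f
proof induction
  case (gen g)
  then show ?case by (rule G)
next
  case (const c)
  show ?case by (rule exI[of _ "\<lambda>x b. 0"]) (auto intro: function_algebra.const)
next
  case (add f g)
  then obtain Df Dg where "\<forall>x\<in>U. (f has_derivative Df x) (at x)" "\<forall>b. function_algebra G (\<lambda>x. Df x b)"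
    "\<forall>x\<in>U. (g has_derivative Dg x) (at x)" "\<forall>b. function_algebra G (\<lambda>x. Dg x b)" by blast
  then show ?case
    by (intro exI[of _ "\<lambda>x b. Df x b + Dg x b"]) (auto intro: function_algebra.add has_derivative_add)
next
  case (mult f g)
  then obtain Df Dg where "\<forall>x\<in>U. (f has_derivative Df x) (at x)" "\<forall>b. function_algebra G (\<lambda>x. Df x b)"
    "\<forall>x\<in>U. (g has_derivative Dg x) (at x)" "\<forall>b. function_algebra G (\<lambda>x. Dg x b)" by blast
  with mult.hyps show ?case
    by (intro exI[of _ "\<lambda>x b. f x * Dg x b + Df x b * g x"])
       (auto intro!: function_algebra.add function_algebra.mult intro: has_derivative_mult)
qed

lemma has_derivative_vec_componentwise:
  fixes f :: "'a::euclidean_space \<Rightarrow> real^'n"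
  assumes "\<And>i. ((\<lambda>x. f x $ i) has_derivative (\<lambda>h. D h $ i)) (at x within S)"
  shows "(f has_derivative D) (at x within S)"
  using assms by (subst has_derivative_componentwise_within) (auto simp: Basis_vec_def inner_axis)

lemma smooth_on_function_algebra:
  fixes f :: "'a::euclidean_space \<Rightarrow> real^'n"
  assumes U: "open U"
    and G: "\<And>g. g \<in> G \<Longrightarrow> \<exists>D. (\<forall>x\<in>U. (g has_derivative D x) (at x)) \<and> (\<forall>b. function_algebra G (\<lambda>x. D x b))"
    and f: "\<And>i. function_algebra G (\<lambda>x. f x $ i)"
  shows "smooth_on U f"
proof (rule smooth_on_derivation_closed_family[OF U, of _ "{f. \<forall>i. function_algebra G (\<lambda>x. f x $ i)}"])
  show "f \<in> {f. \<forall>i. function_algebra G (\<lambda>x. f x $ i)}" using f by simp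
  fix h :: "'a \<Rightarrow> real^'n" assume "h \<in> {f. \<forall>i. function_algebra G (\<lambda>x. f x $ i)}"
  then have "\<forall>i. \<exists>D. (\<forall>x\<in>U. ((\<lambda>x. h x $ i) has_derivative D x) (at x)) \<and> (\<forall>b. function_algebra G (\<lambda>x. D x b))"
    using function_algebra_derivation[OF G] by blast
  then obtain D where D: "\<And>i x. x \<in> U \<Longrightarrow> ((\<lambda>x. h x $ i) has_derivative D i x) (at x)"
    "\<And>i b. function_algebra G (\<lambda>x. D i x b)" by metis
  show "\<exists>D. (\<forall>x\<in>U. (h has_derivative D x) (at x)) \<and>
      (\<forall>b\<in>Basis. (\<lambda>x. D x b) \<in> {f. \<forall>i. function_algebra G (\<lambda>x. f x $ i)})"
    using D by (intro exI[of _ "\<lambda>x b. \<chi> i. D i x b"]) (auto intro!: has_derivative_vec_componentwise)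
qed

section \<open>The solid torus\<close>

definition planar :: "real^3 \<Rightarrow> complex" where
  "planar x = Complex (x $ 1) (x $ 2)"

definition radial :: "real^3 \<Rightarrow> real" where
  "radial x = norm (planar x)"

text \<open>The position in the half-plane bounded by the axis and containing \<open>x\<close>,
  measured from the centre of the rotating circle. It plays the part of \<open>z\<close> in the
  outline.\<close>

definition meridian :: "real^3 \<Rightarrow> complex" where
  "meridian x = Complex (radial x - 2) (x $ 3)"

text \<open>\<open>u\<close> is the direction about the axis and \<xi> the position in the
  cross-section: off the axis this inverts the pair \<open>planar x / of_real (radial x)\<close>,
  \<open>meridian x\<close>.\<close>

definition torus_point :: "complex \<Rightarrow> complex \<Rightarrow> real^3" where
  "torus_point u \<xi> = vector [(2 + Re \<xi>) * Re u, (2 + Re \<xi>) * Im u, Im \<xi>]"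

definition solid_torus :: "(real^3) set" where
  "solid_torus = {x. norm (meridian x) \<le> 1}"

lemma continuous_planar [continuous_intros]:
  "continuous_on S f \<Longrightarrow> continuous_on S (\<lambda>x. planar (f x))"
  unfolding planar_def complex_eq by (intro continuous_intros) auto

lemma continuous_radial [continuous_intros]:
  "continuous_on S f \<Longrightarrow> continuous_on S (\<lambda>x. radial (f x))"
  unfolding radial_def by (intro continuous_intros)

lemma continuous_meridian [continuous_intros]:
  "continuous_on S f \<Longrightarrow> continuous_on S (\<lambda>x. meridian (f x))"
  unfolding meridian_def complex_eq by (intro continuous_intros) auto

lemma continuous_on_vector3 [continuous_intros]:
  assumes "continuous_on S f" "continuous_on S g" "continuous_on S h"
  shows "continuous_on S (\<lambda>x. vector [f x, g x, h x] :: real^3)"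
proof -
  have "continuous_on S (\<lambda>x. (vector [f x, g x, h x] :: real^3) $ i)" for i
    using exhaust_3[of i] assms by auto
  then show ?thesis
    using continuous_on_vec_lambda[of S "\<lambda>i x. (vector [f x, g x, h x] :: real^3) $ i"] by simp
qed

lemma continuous_on_vector2 [continuous_intros]:
  assumes "continuous_on S f" "continuous_on S g"
  shows "continuous_on S (\<lambda>x. vector [f x, g x] :: real^2)"
proof -
  have "continuous_on S (\<lambda>x. (vector [f x, g x] :: real^2) $ i)" for i
    using exhaust_2[of i] assms by auto
  then show ?thesis
    using continuous_on_vec_lambda[of S "\<lambda>i x. (vector [f x, g x] :: real^2) $ i"] by simp
qed

lemma continuous_torus_point [continuous_intros]:
  "continuous_on S f \<Longrightarrow> continuous_on S g \<Longrightarrow> continuous_on S (\<lambda>x. torus_point (f x) (g x))"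
  unfolding torus_point_def by (intro continuous_intros)

lemma planar_torus_point: "planar (torus_point u \<xi>) = of_real (2 + Re \<xi>) * u"
  by (simp add: planar_def torus_point_def complex_eq_iff)

lemma radial_torus_point:
  "norm u = 1 \<Longrightarrow> -2 \<le> Re \<xi> \<Longrightarrow> radial (torus_point u \<xi>) = 2 + Re \<xi>"
  by (simp add: radial_def planar_torus_point norm_mult del: of_real_add)

lemma meridian_torus_point:
  "norm u = 1 \<Longrightarrow> -2 \<le> Re \<xi> \<Longrightarrow> meridian (torus_point u \<xi>) = \<xi>"
  by (simp add: meridian_def radial_torus_point) (simp add: torus_point_def)

lemma torus_point_sgn_meridian:
  "radial x \<noteq> 0 \<Longrightarrow> torus_point (planar x / of_real (radial x)) (meridian x) = x"
  by (simp add: torus_point_def vec_eq_iff forall_3 meridian_def) (simp add: planar_def)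

lemma one_le_radial: "norm (meridian x) \<le> 1 \<Longrightarrow> 1 \<le> radial x"
  using abs_Re_le_cmod[of "meridian x"] by (simp add: meridian_def)

lemma torus_pointE:
  assumes "norm (meridian x) \<le> 1"
  obtains u where "norm u = 1" "x = torus_point u (meridian x)"
proof
  have "1 \<le> radial x" using assms by (rule one_le_radial)
  then show "x = torus_point (planar x / of_real (radial x)) (meridian x)"
    by (simp add: torus_point_sgn_meridian)
  show "norm (planar x / of_real (radial x)) = 1"
    using \<open>1 \<le> radial x\<close> by (auto simp: norm_divide radial_def)
qed

text \<open>Scaling the cross-section coordinate by \<open>s\<close> moves a point inside for
  \<open>s < 1\<close> and pushes a boundary point out for \<open>s > 1\<close>; interior and
  closure are computed along this path. The bound \<open>s \<le> 2\<close> keeps the real part at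
  least -2, so that the path does not cross the axis.\<close>

lemma torus_point_radial_limit:
  assumes "norm (meridian x) \<le> 1"
  obtains h where "continuous_on UNIV h" "h 1 = x"
    "\<And>s. 0 \<le> s \<Longrightarrow> s \<le> 2 \<Longrightarrow> meridian (h s) = of_real s * meridian x"
proof -
  obtain u where u: "norm u = 1" "x = torus_point u (meridian x)"
    using assms by (rule torus_pointE)
  show thesis
  proof
    show "continuous_on UNIV (\<lambda>s. torus_point u (of_real s * meridian x))"
      by (intro continuous_intros)
    fix s :: real assume s: "0 \<le> s" "s \<le> 2"
    have "\<bar>s * Re (meridian x)\<bar> \<le> 2 * 1"
      unfolding abs_mult using s abs_Re_le_cmod[of "meridian x"] assms by (intro mult_mono) auto
    then show "meridian (torus_point u (of_real s * meridian x)) = of_real s * meridian x"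
      using u by (intro meridian_torus_point) auto
  qed (use u in simp)
qed

lemma open_inner_torus: "open {x. norm (meridian x) < 1}"
  by (intro open_Collect_less continuous_intros)

lemma interior_solid_torus: "interior solid_torus = {x. norm (meridian x) < 1}"
proof
  show "{x. norm (meridian x) < 1} \<subseteq> interior solid_torus"
    by (rule interior_maximal[OF _ open_inner_torus]) (auto simp: solid_torus_def)
  show "interior solid_torus \<subseteq> {x. norm (meridian x) < 1}"
  proof (rule ccontr)
    assume "\<not> interior solid_torus \<subseteq> {x. norm (meridian x) < 1}"
    then obtain x where x: "x \<in> interior solid_torus" "\<not> norm (meridian x) < 1" by blast
    then have 1: "norm (meridian x) = 1"
      using interior_subset[of solid_torus] by (force simp: solid_torus_def)
    then obtain h where h: "continuous_on UNIV h" "h 1 = x"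
      "\<And>s. 0 \<le> s \<Longrightarrow> s \<le> 2 \<Longrightarrow> meridian (h s) = of_real s * meridian x"
      using torus_point_radial_limit[of x] by auto
    have "open (h -` interior solid_torus)"
      using h(1) by (intro open_vimage) auto
    moreover have "1 \<in> h -` interior solid_torus" using h x by simp
    ultimately obtain e where e: "e > 0" "ball 1 e \<subseteq> h -` interior solid_torus"
      using open_contains_ball by blast
    \<comment> \<open>This value exceeds 1, stays in the ball around 1 and respects the bound 2. So
      \<open>h s\<close> lies in the torus although its cross-section coordinate has norm
      \<open>s\<close>.\<close>
    define s where "s = 1 + min (e/2) 1"
    have s: "1 < s" "s \<le> 2" "s \<in> ball 1 e" using e(1) by (auto simp: s_def dist_norm min_def)
    then have "h s \<in> solid_torus" using e(2) interior_subset by blast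
    then show False using h(3)[of s] s 1 by (simp add: solid_torus_def norm_mult)
  qed
qed

lemma closed_solid_torus: "closed solid_torus"
  unfolding solid_torus_def by (intro closed_Collect_le continuous_intros)

lemma closure_interior_solid_torus: "closure (interior solid_torus) = solid_torus"
proof
  show "closure (interior solid_torus) \<subseteq> solid_torus"
    by (intro closure_minimal interior_subset closed_solid_torus)
  show "solid_torus \<subseteq> closure (interior solid_torus)"
  proof
    fix x assume "x \<in> solid_torus"
    then have x: "norm (meridian x) \<le> 1" by (simp add: solid_torus_def)
    then obtain h where h: "continuous_on UNIV h" "h 1 = x"
      "\<And>s. 0 \<le> s \<Longrightarrow> s \<le> 2 \<Longrightarrow> meridian (h s) = of_real s * meridian x"
      using torus_point_radial_limit[of x] by auto
    have "h ` closure {0..<1} \<subseteq> closure (interior solid_torus)"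
    proof (rule image_closure_subset)
      show "continuous_on (closure {0..<1}) h" using h(1) by (rule continuous_on_subset) auto
      have "s * norm (meridian x) < 1" if "0 \<le> s" "s < 1" for s
        using that x mult_left_le[of "norm (meridian x)" s] by auto
      then show "h ` {0..<1} \<subseteq> closure (interior solid_torus)"
        using h(3) by (auto intro!: closure_subset[THEN subsetD] simp: interior_solid_torus norm_mult)
    qed simp
    then show "x \<in> closure (interior solid_torus)" using h(2) by force
  qed
qed

lemma frontier_solid_torus: "frontier solid_torus = {x. norm (meridian x) = 1}"
  unfolding frontier_def closure_closed[OF closed_solid_torus] interior_solid_torus
  by (auto simp: solid_torus_def)

lemma compact_solid_torus: "compact solid_torus"
  unfolding compact_eq_bounded_closed
proof
  have "norm x \<le> 4" if "x \<in> solid_torus" for x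
  proof -
    have "norm (meridian x) \<le> 1" using that by (simp add: solid_torus_def)
    then have "\<bar>Re (meridian x)\<bar> \<le> 1" "\<bar>Im (meridian x)\<bar> \<le> 1"
      using abs_Re_le_cmod[of "meridian x"] abs_Im_le_cmod[of "meridian x"] by linarith+
    then have "radial x \<le> 3" "\<bar>x $ 3\<bar> \<le> 1" "0 \<le> radial x"
      by (auto simp: meridian_def radial_def)
    then have "radial x ^ 2 \<le> 3^2" "(x $ 3)^2 \<le> 1"
      by (simp_all only: power_mono abs_square_le_1)
    moreover have "norm x ^ 2 = radial x ^ 2 + (x $ 3)^2"
      by (simp add: radial_def planar_def cmod_power2 norm_vec_def L2_set_def sum_3 real_sqrt_pow2 del: real_sqrt_pow2_iff)
    ultimately have "norm x ^ 2 \<le> 4^2" by simp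
    then show ?thesis by (rule power2_le_imp_le) simp
  qed
  then show "bounded solid_torus" by (auto simp: bounded_iff)
qed (rule closed_solid_torus)

text \<open>The set is a continuous image of the circle times \<open>A\<close>. Here
  \<open>A\<close> will be the open unit disk for the interior and the unit circle for the
  boundary.\<close>

lemma connected_torus_image:
  assumes "connected A" "A \<subseteq> cball 0 1"
  shows "connected {x. meridian x \<in> A}"
proof -
  have "{x. meridian x \<in> A} = (\<lambda>(u, \<xi>). torus_point u \<xi>) ` (sphere 0 1 \<times> A)"
  proof (intro equalityI subsetI)
    fix x assume "x \<in> {x. meridian x \<in> A}"
    then have "meridian x \<in> A" "norm (meridian x) \<le> 1" using assms(2) by auto
    then show "x \<in> (\<lambda>(u, \<xi>). torus_point u \<xi>) ` (sphere 0 1 \<times> A)"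
      by (auto elim!: torus_pointE intro!: image_eqI)
  next
    fix x assume "x \<in> (\<lambda>(u, \<xi>). torus_point u \<xi>) ` (sphere 0 1 \<times> A)"
    then obtain u \<xi> where u: "norm u = 1" "\<xi> \<in> A" "x = torus_point u \<xi>" by auto
    then have "norm \<xi> \<le> 1" using assms(2) by auto
    then have "-2 \<le> Re \<xi>" using abs_Re_le_cmod[of \<xi>] by simp
    then show "x \<in> {x. meridian x \<in> A}" using u by (simp add: meridian_torus_point)
  qed
  moreover have "connected (sphere (0::complex) 1 \<times> A)"
    using assms by (intro connected_Times connected_sphere) auto
  ultimately show ?thesis
    by (auto intro!: connected_continuous_image continuous_intros simp: case_prod_unfold)
qed

lemma connected_interior_solid_torus: "connected (interior solid_torus)"
  using connected_torus_image[of "ball 0 1"] by (simp add: interior_solid_torus)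

lemma connected_frontier_solid_torus: "connected (frontier solid_torus)"
  using connected_torus_image[of "sphere 0 1"] connected_sphere[of "0::complex" 1]
  by (simp add: frontier_solid_torus)

subsection \<open>Angular coordinates\<close>

lemma cis_Arg_on_slit_plane:
  assumes "z \<notin> \<real>\<^sub>\<le>\<^sub>0"
  shows "\<bar>Arg z\<bar> < pi" "of_real (norm z) * cis (Arg z) = z"
proof -
  have "z \<noteq> 0" using assms by auto
  then show "of_real (norm z) * cis (Arg z) = z" by (simp add: cis_Arg sgn_eq)
  have "Arg z \<noteq> pi" using assms by (auto simp: Arg_eq_pi complex_nonpos_Reals_iff)
  then show "\<bar>Arg z\<bar> < pi" using mpi_less_Arg[of z] Arg_le_pi[of z] by (auto simp: abs_less_iff)
qed

lemma cis_in_slit_plane: "\<bar>a\<bar> < pi \<Longrightarrow> 0 < r \<Longrightarrow> of_real r * cis a \<notin> \<real>\<^sub>\<le>\<^sub>0"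
proof
  assume a: "\<bar>a\<bar> < pi" "0 < r" "of_real r * cis a \<in> \<real>\<^sub>\<le>\<^sub>0"
  then have "Arg (of_real r * cis a) = a" by (auto simp: Arg_cis abs_less_iff)
  moreover have "Arg (of_real r * cis a) = pi"
    using a sin_zero_abs_cos_one[of a]
    by (auto simp: Arg_eq_pi complex_nonpos_Reals_iff mult_le_0_iff)
  ultimately show False using a by simp
qed

text \<open>\<open>a\<close> and \<open>b\<close> are reference angles, \<open>q $ 1\<close> and
  \<open>q $ 2\<close> the longitude and the cross-section angle measured from them, and
  \<open>q $ 3\<close> the depth below the boundary, so that the boundary becomes the face
  \<open>q $ 3 = 0\<close> of a half-space.\<close>

definition torus_chart :: "real \<Rightarrow> real \<Rightarrow> real^3 \<Rightarrow> real^3" where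
  "torus_chart a b q = torus_point (cis (a + q $ 1)) (of_real (1 - q $ 3) * cis (b + q $ 2))"

text \<open>\<open>pi + Arg (- z)\<close> is the branch of the argument of \<open>z\<close> between
  0 and \<open>2 * pi\<close>, cut along the positive real axis.\<close>

definition torus_coord :: "real \<Rightarrow> real \<Rightarrow> real^3 \<Rightarrow> real^3" where
  "torus_coord a b x = vector [Arg (planar x * cis (- a)), pi + Arg (- (meridian x * cis (- b))),
     1 - norm (meridian x)]"

text \<open>The second angle runs from 0 to \<open>2 * pi\<close>, not symmetrically about 0, so
  that the first two coordinates range over an open subset of the half-plane
  \<open>0 \<le> x $ 2\<close>, the model required of a face.\<close>

definition chart_domain :: "(real^3) set" where
  "chart_domain = {q. \<bar>q $ 1\<bar> < pi \<and> 0 < q $ 2 \<and> q $ 2 < 2 * pi \<and> 0 \<le> q $ 3 \<and> q $ 3 < 1}"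

definition chart_nbhd :: "real \<Rightarrow> real \<Rightarrow> (real^3) set" where
  "chart_nbhd a b = {x. planar x * cis (- a) \<notin> \<real>\<^sub>\<le>\<^sub>0 \<and> - (meridian x * cis (- b)) \<notin> \<real>\<^sub>\<le>\<^sub>0}"

lemma open_chart_nbhd: "open (chart_nbhd a b)"
proof -
  have "open ((\<lambda>x. planar x * cis (- a)) -` (- \<real>\<^sub>\<le>\<^sub>0) \<inter> (\<lambda>x. - (meridian x * cis (- b))) -` (- \<real>\<^sub>\<le>\<^sub>0))"
    by (intro open_Int open_vimage continuous_intros) auto
  then show ?thesis by (simp add: chart_nbhd_def vimage_def Int_def)
qed

lemma chart_domain_torus_chart:
  assumes q: "q \<in> chart_domain"
  shows "norm (meridian (torus_chart a b q)) = 1 - q $ 3"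
    and "torus_chart a b q \<in> chart_nbhd a b" "torus_coord a b (torus_chart a b q) = q"
proof -
  define s where "s = 1 - q $ 3"
  define \<xi> where "\<xi> = of_real s * cis (b + q $ 2)"
  have s: "0 < s" "s \<le> 1" using q by (auto simp: s_def chart_domain_def)
  have n: "norm \<xi> = s" using s by (simp add: \<xi>_def norm_mult)
  then have re: "-1 \<le> Re \<xi>" using abs_Re_le_cmod[of \<xi>] s by simp
  have c: "torus_chart a b q = torus_point (cis (a + q $ 1)) \<xi>"
    by (simp add: torus_chart_def \<xi>_def s_def)
  have mer: "meridian (torus_chart a b q) = \<xi>"
    unfolding c using re by (intro meridian_torus_point) auto
  show "norm (meridian (torus_chart a b q)) = 1 - q $ 3" using n by (simp add: mer s_def)
  have 1: "planar (torus_chart a b q) * cis (- a) = of_real (2 + Re \<xi>) * cis (q $ 1)"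
    unfolding c planar_torus_point by (simp add: cis_mult mult.assoc)
  have 2: "- (meridian (torus_chart a b q) * cis (- b)) = of_real s * cis (q $ 2 - pi)"
    unfolding mer \<xi>_def by (simp add: cis_mult mult.assoc flip: cis_divide)
  have a: "\<bar>q $ 1\<bar> < pi" "\<bar>q $ 2 - pi\<bar> < pi" using q by (auto simp: chart_domain_def)
  show "torus_chart a b q \<in> chart_nbhd a b"
    unfolding chart_nbhd_def mem_Collect_eq 1 2
    using a s re by (intro conjI cis_in_slit_plane) auto
  have "Arg (of_real (2 + Re \<xi>) * cis (q $ 1)) = q $ 1" "Arg (of_real s * cis (q $ 2 - pi)) = q $ 2 - pi"
    using a s re by (simp_all add: Arg_cis abs_less_iff del: of_real_add)
  then show "torus_coord a b (torus_chart a b q) = q"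
    unfolding torus_coord_def 1 2 using n by (simp add: mer vec_eq_iff forall_3 s_def)
qed

lemma chart_nbhd_torus_coord:
  assumes x: "x \<in> chart_nbhd a b" "x \<in> solid_torus"
  shows "torus_coord a b x \<in> chart_domain" "torus_chart a b (torus_coord a b x) = x"
proof -
  have sl: "planar x * cis (- a) \<notin> \<real>\<^sub>\<le>\<^sub>0" "- (meridian x * cis (- b)) \<notin> \<real>\<^sub>\<le>\<^sub>0"
    using x by (auto simp: chart_nbhd_def)
  have m: "0 < norm (meridian x)" "norm (meridian x) \<le> 1" using x sl by (auto simp: solid_torus_def)
  show "torus_coord a b x \<in> chart_domain"
    using cis_Arg_on_slit_plane(1)[OF sl(1)] cis_Arg_on_slit_plane(1)[OF sl(2)] m
    by (auto simp: chart_domain_def torus_coord_def abs_less_iff)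
  have "cis (a + Arg (planar x * cis (- a))) = planar x / of_real (radial x)"
  proof -
    have "of_real (radial x) * cis (a + Arg (planar x * cis (- a))) =
        cis a * (of_real (norm (planar x * cis (- a))) * cis (Arg (planar x * cis (- a))))"
      by (simp add: radial_def norm_mult cis_mult[symmetric])
    also have "\<dots> = planar x"
      unfolding cis_Arg_on_slit_plane(2)[OF sl(1)] by (simp add: cis_mult mult.left_commute)
    finally show ?thesis using one_le_radial[OF m(2)] by (auto simp: field_simps)
  qed
  moreover have "of_real (norm (meridian x)) * cis (b + (pi + Arg (- (meridian x * cis (- b))))) = meridian x"
  proof -
    have "of_real (norm (meridian x)) * cis (b + (pi + Arg (- (meridian x * cis (- b))))) =
        - cis b * (of_real (norm (- (meridian x * cis (- b)))) * cis (Arg (- (meridian x * cis (- b)))))"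
      by (simp add: norm_mult cis_mult[symmetric])
    also have "\<dots> = meridian x"
      unfolding cis_Arg_on_slit_plane(2)[OF sl(2)] by (simp add: cis_mult mult.left_commute)
    finally show ?thesis .
  qed
  ultimately show "torus_chart a b (torus_coord a b x) = x"
    using one_le_radial[OF m(2)] by (simp add: torus_chart_def torus_coord_def torus_point_sgn_meridian)
qed

lemma continuous_torus_chart [continuous_intros]:
  "continuous_on S f \<Longrightarrow> continuous_on S (\<lambda>x. torus_chart a b (f x))"
  unfolding torus_chart_def by (intro continuous_intros)

lemma continuous_torus_coord: "continuous_on (chart_nbhd a b) (torus_coord a b)"
  unfolding torus_coord_def by (intro continuous_intros) (auto simp: chart_nbhd_def)

lemma homeomorphism_torus_chart:
  "homeomorphism chart_domain (solid_torus \<inter> chart_nbhd a b) (torus_chart a b) (torus_coord a b)"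
proof (rule homeomorphismI)
  show "continuous_on chart_domain (torus_chart a b)" by (intro continuous_intros)
  show "continuous_on (solid_torus \<inter> chart_nbhd a b) (torus_coord a b)"
    using continuous_torus_coord by (rule continuous_on_subset) auto
qed (use chart_domain_torus_chart chart_nbhd_torus_coord in \<open>auto simp: solid_torus_def chart_domain_def\<close>)

lemma mult_cis_minus_Arg: "z * cis (- Arg z) = of_real (norm z)"
proof -
  have "z = of_real (norm z) * cis (Arg z)" using rcis_cmod_Arg[of z] by (simp add: rcis_def)
  then have "z * cis (- Arg z) = of_real (norm z) * (cis (Arg z) * cis (- Arg z))"
    by (metis mult.assoc)
  then show ?thesis by (simp add: cis_mult)
qed

text \<open>The reference angles give \<open>p\<close> the longitude 0 and the cross-section angle
  \<open>pi\<close>, the midpoints of both ranges, away from the cuts.\<close>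

lemma chart_nbhd_at_frontier:
  assumes "p \<in> frontier solid_torus"
  obtains a b where "p \<in> chart_nbhd a b"
proof
  have p: "norm (meridian p) = 1" using assms by (simp add: frontier_solid_torus)
  have r: "1 \<le> radial p" using p by (intro one_le_radial) simp
  have 1: "planar p * cis (- Arg (planar p)) = of_real (radial p)"
    by (simp add: radial_def mult_cis_minus_Arg)
  have "cis (- Arg (meridian p) - pi) = - cis (- Arg (meridian p))"
    using cis_divide[of "- Arg (meridian p)" pi] by simp
  then have 2: "- (meridian p * cis (- (Arg (meridian p) + pi))) = 1"
    using p mult_cis_minus_Arg[of "meridian p"] by simp
  show "p \<in> chart_nbhd (Arg (planar p)) (Arg (meridian p) + pi)"
    unfolding chart_nbhd_def mem_Collect_eq 1 2 using r by (simp add: complex_nonpos_Reals_iff)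
qed

lemma compact_domain_solid_torus: "compact_domain solid_torus"
  unfolding compact_domain_def
proof (intro conjI)
  show "compact solid_torus" "connected (interior solid_torus)" "closure (interior solid_torus) = solid_torus"
    by (rule compact_solid_torus connected_interior_solid_torus closure_interior_solid_torus)+
  have "vector [2, 0, 0] \<in> interior solid_torus"
    by (simp add: interior_solid_torus meridian_def radial_def planar_def cmod_def)
  then show "interior solid_torus \<noteq> {}" by blast
  show "locally_modelled_on solid_torus {x::real^3. 0 \<le> x $ 3}"
    unfolding locally_modelled_on_def
  proof
    fix p assume p: "p \<in> solid_torus"
    show "\<exists>V W. openin (top_of_set solid_torus) V \<and> p \<in> V \<and>
        openin (top_of_set {x::real^3. 0 \<le> x $ 3}) W \<and> V homeomorphic W"
    proof (cases "p \<in> interior solid_torus")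
      case True
      \<comment> \<open>The interior serves as its own chart: its third coordinate is at least -1,
        so a lift by 2 puts it into the half-space as an open subset of space.\<close>
      let ?W = "(+) (vector [0, 0, 2]) ` interior solid_torus"
      have "-1 \<le> x $ 3" if "x \<in> interior solid_torus" for x
        using that abs_Im_le_cmod[of "meridian x"] by (auto simp: interior_solid_torus meridian_def)
      then have "?W \<subseteq> {x. 0 \<le> x $ 3}" by fastforce
      then have "openin (top_of_set {x::real^3. 0 \<le> x $ 3}) ?W"
        by (intro open_subset open_translation open_interior)
      then show ?thesis
        using True homeomorphic_translation
        by (intro exI[of _ "interior solid_torus"] exI[of _ ?W] conjI)
          (simp_all add: open_subset interior_subset)
    next
      case False
      then have "p \<in> frontier solid_torus"
        using p closed_solid_torus by (simp add: frontier_def)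
      then obtain a b where ab: "p \<in> chart_nbhd a b" by (rule chart_nbhd_at_frontier)
      \<comment> \<open>The only non-strict inequality is that of the half-space itself, so the
        domain is relatively open in it.\<close>
      have "chart_domain = {x. 0 \<le> x $ 3} \<inter> {q. \<bar>q $ 1\<bar> < pi \<and> 0 < q $ 2 \<and> q $ 2 < 2 * pi \<and> q $ 3 < 1}"
        by (auto simp: chart_domain_def)
      moreover have "open {q::real^3. \<bar>q $ 1\<bar> < pi \<and> 0 < q $ 2 \<and> q $ 2 < 2 * pi \<and> q $ 3 < 1}"
        by (intro open_Collect_conj open_Collect_less continuous_intros)
      ultimately have "openin (top_of_set {x::real^3. 0 \<le> x $ 3}) chart_domain"
        unfolding openin_open by blast
      moreover have "solid_torus \<inter> chart_nbhd a b homeomorphic chart_domain"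
        using homeomorphism_torus_chart[of a b] homeomorphic_def homeomorphic_sym by blast
      ultimately show ?thesis
        using p ab open_chart_nbhd[of a b]
        by (intro exI[of _ "solid_torus \<inter> chart_nbhd a b"] exI[of _ chart_domain] conjI)
             (simp_all add: openin_open_Int)
    qed
  qed
qed

section \<open>The boundary torus as a smooth surface\<close>

definition surface_domain :: "(real^2) set" where
  "surface_domain = {q. \<bar>q $ 1\<bar> < pi \<and> 0 < q $ 2 \<and> q $ 2 < 2 * pi}"

definition surface_chart :: "real \<Rightarrow> real \<Rightarrow> real^2 \<Rightarrow> real^3" where
  "surface_chart a b q = torus_chart a b (vector [q $ 1, q $ 2, 0])"

definition surface_coord :: "real \<Rightarrow> real \<Rightarrow> real^3 \<Rightarrow> real^2" where
  "surface_coord a b x = vector [torus_coord a b x $ 1, torus_coord a b x $ 2]"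

lemma open_surface_domain: "open surface_domain"
  unfolding surface_domain_def by (intro open_Collect_conj open_Collect_less continuous_intros)

lemma homeomorphism_surface_chart:
  "homeomorphism surface_domain (frontier solid_torus \<inter> chart_nbhd a b) (surface_chart a b) (surface_coord a b)"
proof (rule homeomorphismI)
  show "continuous_on surface_domain (surface_chart a b)"
    unfolding surface_chart_def by (intro continuous_intros)
  have "continuous_on (frontier solid_torus \<inter> chart_nbhd a b) (torus_coord a b)"
    using continuous_torus_coord by (rule continuous_on_subset) auto
  then show "continuous_on (frontier solid_torus \<inter> chart_nbhd a b) (surface_coord a b)"
    unfolding surface_coord_def by (intro continuous_intros)
  have dom: "vector [q $ 1, q $ 2, 0] \<in> chart_domain" if "q \<in> surface_domain" for q :: "real^2"
    using that by (simp add: surface_domain_def chart_domain_def)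
  show "surface_chart a b ` surface_domain \<subseteq> frontier solid_torus \<inter> chart_nbhd a b"
    using chart_domain_torus_chart[OF dom] by (auto simp: surface_chart_def frontier_solid_torus)
  show "surface_coord a b (surface_chart a b q) = q" if "q \<in> surface_domain" for q
    using chart_domain_torus_chart(3)[OF dom[OF that], of a b]
    by (simp add: surface_chart_def surface_coord_def vec_eq_iff forall_2)
  fix x assume x: "x \<in> frontier solid_torus \<inter> chart_nbhd a b"
  then have x': "x \<in> chart_nbhd a b" "x \<in> solid_torus" "norm (meridian x) = 1"
    using frontier_subset_closed[OF closed_solid_torus] by (auto simp: frontier_solid_torus)
  have eq: "vector [torus_coord a b x $ 1, torus_coord a b x $ 2, 0] = torus_coord a b x"
    using x'(3) by (simp add: vec_eq_iff forall_3 torus_coord_def)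
  show "surface_chart a b (surface_coord a b x) = x"
    using chart_nbhd_torus_coord(2)[OF x'(1,2)] by (simp add: surface_chart_def surface_coord_def eq)
next
  show "surface_coord a b ` (frontier solid_torus \<inter> chart_nbhd a b) \<subseteq> surface_domain"
  proof safe
    fix x assume x: "x \<in> frontier solid_torus" "x \<in> chart_nbhd a b"
    then have "x \<in> solid_torus" using frontier_subset_closed[OF closed_solid_torus] by blast
    with chart_nbhd_torus_coord(1)[OF x(2)] show "surface_coord a b x \<in> surface_domain"
      by (simp add: surface_coord_def surface_domain_def chart_domain_def)
  qed
qed

lemma frontier_solid_torus_locally_modelled:
  "locally_modelled_on (frontier solid_torus) {x::real^2. 0 \<le> x $ 2}"
  unfolding locally_modelled_on_def
proof
  fix p assume p: "p \<in> frontier solid_torus"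
  then obtain a b where ab: "p \<in> chart_nbhd a b" by (rule chart_nbhd_at_frontier)
  have "openin (top_of_set {x::real^2. 0 \<le> x $ 2}) surface_domain"
    using open_surface_domain by (rule open_subset[rotated]) (auto simp: surface_domain_def)
  moreover have "frontier solid_torus \<inter> chart_nbhd a b homeomorphic surface_domain"
    using homeomorphism_surface_chart[of a b] homeomorphic_def homeomorphic_sym by blast
  ultimately show "\<exists>V W. openin (top_of_set (frontier solid_torus)) V \<and> p \<in> V \<and>
      openin (top_of_set {x::real^2. 0 \<le> x $ 2}) W \<and> V homeomorphic W"
    using p ab open_chart_nbhd[of a b]
    by (intro exI[of _ "frontier solid_torus \<inter> chart_nbhd a b"] exI[of _ surface_domain] conjI)
      (simp_all add: openin_open_Int)
qed

lemma surface_chart_components: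
  "surface_chart a b q $ 1 = (2 + cos (b + q $ 2)) * cos (a + q $ 1)"
  "surface_chart a b q $ 2 = (2 + cos (b + q $ 2)) * sin (a + q $ 1)"
  "surface_chart a b q $ 3 = sin (b + q $ 2)"
  by (simp_all add: surface_chart_def torus_chart_def torus_point_def)

lemma has_derivative_vec_nth [derivative_intros]:
  "(f has_derivative f') F \<Longrightarrow> ((\<lambda>x. f x $ i) has_derivative (\<lambda>h. f' h $ i)) F"
  by (rule bounded_linear.has_derivative[OF bounded_linear_vec_nth])

text \<open>The components are polynomials in sines and cosines of shifted coordinates, and a
  directional derivative of such a generator is a constant multiple of another one.\<close>

lemma smooth_on_surface_chart: "smooth_on surface_domain (surface_chart a b)"
proof -
  define G where "G = {\<lambda>q::real^2. trig (c + q $ i) | trig c i. trig = sin \<or> trig = cos}"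
  have gen: "function_algebra G (\<lambda>q. sin (c + q $ i))" "function_algebra G (\<lambda>q. cos (c + q $ i))" for c i
    by (auto simp: G_def intro!: function_algebra.gen)
  show ?thesis
  proof (rule smooth_on_function_algebra[OF open_surface_domain])
    show "function_algebra G (\<lambda>q. surface_chart a b q $ i)" for i
      using exhaust_3[of i] by (auto simp: surface_chart_components intro!: gen function_algebra.intros(2-))
    fix g assume "g \<in> G"
    then obtain c i where "g = (\<lambda>q. sin (c + q $ i)) \<or> g = (\<lambda>q. cos (c + q $ i))"
      unfolding G_def by blast
    then show "\<exists>D. (\<forall>q\<in>surface_domain. (g has_derivative D q) (at q)) \<and> (\<forall>h. function_algebra G (\<lambda>q. D q h))"
    proof
      assume g: "g = (\<lambda>q. sin (c + q $ i))"
      have "(g has_derivative (\<lambda>h. h $ i * cos (c + q $ i))) (at q)" for q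
        unfolding g by (auto intro!: derivative_eq_intros)
      moreover have "function_algebra G (\<lambda>q. h $ i * cos (c + q $ i))" for h
        by (intro function_algebra.intros(2-) gen)
      ultimately show ?thesis by (intro exI[of _ "\<lambda>q h. h $ i * cos (c + q $ i)"]) blast
    next
      assume g: "g = (\<lambda>q. cos (c + q $ i))"
      have "(g has_derivative (\<lambda>h. (- h $ i) * sin (c + q $ i))) (at q)" for q
        unfolding g by (auto intro!: derivative_eq_intros)
      moreover have "function_algebra G (\<lambda>q. (- h $ i) * sin (c + q $ i))" for h
        by (intro function_algebra.intros(2-) gen)
      ultimately show ?thesis by (intro exI[of _ "\<lambda>q h. (- h $ i) * sin (c + q $ i)"]) blast
    qed
  qed
qed

text \<open>The squared length of \<open>D h\<close> is
  \<open>(h $ 2)^2 + ((2 + cos \<beta>) * h $ 1)^2\<close>, the first fundamental form of the torus;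
  it is definite because \<open>2 + cos \<beta>\<close> is positive.\<close>

lemma inj_derivative_surface_chart: "inj (frechet_derivative (surface_chart a b) (at q))"
proof -
  define \<alpha> \<beta> where "\<alpha> = a + q $ 1" and "\<beta> = b + q $ 2"
  define D :: "real^2 \<Rightarrow> real^3" where "D h = vector
    [- (h $ 2) * sin \<beta> * cos \<alpha> - (2 + cos \<beta>) * sin \<alpha> * h $ 1,
     - (h $ 2) * sin \<beta> * sin \<alpha> + (2 + cos \<beta>) * cos \<alpha> * h $ 1,
     cos \<beta> * h $ 2]" for h
  have D: "(surface_chart a b has_derivative D) (at q)"
  proof (rule has_derivative_vec_componentwise)
    have "((\<lambda>q. surface_chart a b q $ 1) has_derivative (\<lambda>h. D h $ 1)) (at q)"
      "((\<lambda>q. surface_chart a b q $ 2) has_derivative (\<lambda>h. D h $ 2)) (at q)"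
      "((\<lambda>q. surface_chart a b q $ 3) has_derivative (\<lambda>h. D h $ 3)) (at q)"
      unfolding surface_chart_components D_def vector_3 \<alpha>_def \<beta>_def
      by (auto intro!: derivative_eq_intros simp: algebra_simps fun_eq_iff)
    then show "((\<lambda>q. surface_chart a b q $ i) has_derivative (\<lambda>h. D h $ i)) (at q)" for i
      using exhaust_3[of i] by metis
  qed
  then have "linear D" by (rule has_derivative_linear)
  moreover have "h = 0" if "D h = 0" for h
  proof -
    have "(D h $ 1)^2 + (D h $ 2)^2 + (D h $ 3)^2 = 0" using that by simp
    \<comment> \<open>Letters replace the sines and cosines and \<open>s^2 + c^2\<close> is kept, so
      the identity is purely polynomial; Pythagoras enters afterwards.\<close>
    moreover have "(- y * S * c - k * s * x)^2 + (- y * S * s + k * c * x)^2 + (C * y)^2 =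
        y^2 * (S^2 * (s^2 + c^2) + C^2) + k^2 * x^2 * (s^2 + c^2)" for x y k s c S C :: real
      by algebra
    then have "(D h $ 1)^2 + (D h $ 2)^2 + (D h $ 3)^2 =
        (h $ 2)^2 * (sin \<beta>^2 * (sin \<alpha>^2 + cos \<alpha>^2) + cos \<beta>^2) + (2 + cos \<beta>)^2 * (h $ 1)^2 * (sin \<alpha>^2 + cos \<alpha>^2)"
      unfolding D_def vector_3 by blast
    ultimately have "(h $ 2)^2 + ((2 + cos \<beta>) * h $ 1)^2 = 0" by (simp add: power_mult_distrib)
    then have "h $ 2 = 0" "(2 + cos \<beta>) * h $ 1 = 0"
      by (auto simp: add_nonneg_eq_0_iff)
    moreover have "2 + cos \<beta> \<noteq> 0" using cos_ge_minus_one[of \<beta>] by linarith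
    ultimately show ?thesis by (simp add: vec_eq_iff forall_2)
  qed
  ultimately have "inj D" by (simp add: linear_injective_0)
  then show ?thesis using frechet_derivative_at[OF D] by simp
qed

lemma smooth_surface_frontier_solid_torus: "smooth_surface (frontier solid_torus)"
  unfolding smooth_surface_def
proof
  fix p assume "p \<in> frontier solid_torus"
  then obtain a b where "p \<in> chart_nbhd a b" by (rule chart_nbhd_at_frontier)
  then show "\<exists>U V \<phi> \<psi>. open U \<and> p \<in> U \<and> open V \<and> homeomorphism V (frontier solid_torus \<inter> U) \<phi> \<psi> \<and>
      smooth_on (V::(real^2) set) \<phi> \<and> (\<forall>x\<in>V. inj (frechet_derivative \<phi> (at x)))"
    using open_chart_nbhd open_surface_domain homeomorphism_surface_chart smooth_on_surface_chart
      inj_derivative_surface_chart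
    by (intro exI[of _ "chart_nbhd a b"] exI[of _ surface_domain] exI[of _ "surface_chart a b"]
        exI[of _ "surface_coord a b"] conjI ballI)
qed

subsection \<open>Mean curvature\<close>

lemma radial_altdef: "radial x = sqrt ((x $ 1)^2 + (x $ 2)^2)"
  by (simp add: radial_def planar_def cmod_def)

lemma radial_squared: "radial x ^ 2 = (x $ 1)^2 + (x $ 2)^2"
  by (simp add: radial_altdef)

lemma has_derivative_radial:
  assumes "0 < radial x"
  shows "(radial has_derivative (\<lambda>h. (x $ 1 * h $ 1 + x $ 2 * h $ 2) * inverse (radial x))) (at x)"
proof -
  have pos: "0 < (x $ 1)^2 + (x $ 2)^2" using assms by (simp add: radial_altdef)
  have "((\<lambda>x. (x $ 1)^2 + (x $ 2)^2) has_derivative (\<lambda>h. 2 * (x $ 1 * h $ 1 + x $ 2 * h $ 2))) (at x)"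
    by (auto intro!: derivative_eq_intros simp: fun_eq_iff algebra_simps)
  from has_derivative_real_sqrt[OF pos this] show ?thesis
    unfolding radial_altdef[abs_def] by (rule has_derivative_eq_rhs)
      (rule ext, simp only: times_divide_eq_left[symmetric] mult_divide_mult_cancel_left_if divide_inverse, simp)
qed

text \<open>Written with powers of \<open>inverse (radial x)\<close>, the derivative is again
  polynomial in the coordinates and this one function.\<close>

lemma has_derivative_inverse_radial:
  assumes "0 < radial x"
  shows "((\<lambda>x. inverse (radial x)) has_derivative
    (\<lambda>h. - (x $ 1 * h $ 1 + x $ 2 * h $ 2) * inverse (radial x) ^ 3)) (at x)"
proof -
  have eq: "- (i * (y * i) * i) = - y * i ^ 3" for i y :: real
    by (simp add: power3_eq_cube)
  have "radial x \<noteq> 0" using assms by simp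
  from Deriv.has_derivative_inverse[OF this has_derivative_radial[OF assms]]
  show ?thesis unfolding eq .
qed

text \<open>Off the axis this is the vector from \<open>x\<close> to the nearest point of the core
  circle of radius 2. Its length is \<open>norm (meridian x)\<close>, so it is a unit vector on the
  boundary torus.\<close>

definition torus_normal :: "real^3 \<Rightarrow> real^3" where
  "torus_normal x = vector [(2 * inverse (radial x) - 1) * x $ 1, (2 * inverse (radial x) - 1) * x $ 2, - x $ 3]"

lemma open_radial_pos: "open {x. 0 < radial x}"
  by (intro open_Collect_less continuous_intros)

lemma smooth_on_torus_normal: "smooth_on {x. 0 < radial x} torus_normal"
proof -
  define G where "G = insert (\<lambda>x. inverse (radial x)) {\<lambda>x. x $ i | i. True}"
  have gen: "function_algebra G (\<lambda>x. inverse (radial x))" "function_algebra G (\<lambda>x. x $ i)" for i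
    by (auto simp: G_def intro!: function_algebra.gen)
  show ?thesis
  proof (rule smooth_on_function_algebra[OF open_radial_pos])
    have 1: "function_algebra G (\<lambda>x. (2 * inverse (radial x) + (-1)) * x $ j)"
      and 2: "function_algebra G (\<lambda>x. (-1) * x $ 3)" for j
      by (intro function_algebra.intros(2-) gen)+
    show "function_algebra G (\<lambda>x. torus_normal x $ i)" for i
      using exhaust_3[of i] 1 2 by (auto simp: torus_normal_def)
    fix g assume "g \<in> G"
    then consider "g = (\<lambda>x. inverse (radial x))" | i where "g = (\<lambda>x. x $ i)"
      unfolding G_def by blast
    then show "\<exists>D. (\<forall>x\<in>{x. 0 < radial x}. (g has_derivative D x) (at x)) \<and> (\<forall>h. function_algebra G (\<lambda>x. D x h))"
    proof cases
      case 1
      have "function_algebra G (\<lambda>x. ((-1) * (x $ 1 * h $ 1 + x $ 2 * h $ 2)) *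
          (inverse (radial x) * inverse (radial x) * inverse (radial x)))" for h
        by (intro function_algebra.intros(2-) gen)
      then have "function_algebra G (\<lambda>x. - (x $ 1 * h $ 1 + x $ 2 * h $ 2) * inverse (radial x) ^ 3)" for h :: "real^3"
        by (simp add: power3_eq_cube)
      then show ?thesis
        using has_derivative_inverse_radial unfolding 1
        by (intro exI[of _ "\<lambda>x h. - (x $ 1 * h $ 1 + x $ 2 * h $ 2) * inverse (radial x) ^ 3"]) blast
    next
      case (2 i)
      have "function_algebra G (\<lambda>x. h $ i)" for h by (rule function_algebra.const)
      moreover have "(g has_derivative (\<lambda>h. h $ i)) (at x)" for x
        unfolding 2 by (auto intro!: derivative_eq_intros)
      ultimately show ?thesis
        by (intro exI[of _ "\<lambda>x h. h $ i"]) blast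
    qed
  qed
qed

lemma frechet_derivative_torus_normal:
  assumes "0 < radial x"
  shows "frechet_derivative torus_normal (at x) h = vector
    [(2 * inverse (radial x) - 1) * h $ 1 - 2 * (x $ 1 * h $ 1 + x $ 2 * h $ 2) * inverse (radial x) ^ 3 * x $ 1,
     (2 * inverse (radial x) - 1) * h $ 2 - 2 * (x $ 1 * h $ 1 + x $ 2 * h $ 2) * inverse (radial x) ^ 3 * x $ 2,
     - h $ 3]" (is "_ = ?D h")
proof -
  note [derivative_intros] = has_derivative_inverse_radial[OF assms]
  have "((\<lambda>x. torus_normal x $ 1) has_derivative (\<lambda>h. ?D h $ 1)) (at x)"
    "((\<lambda>x. torus_normal x $ 2) has_derivative (\<lambda>h. ?D h $ 2)) (at x)"
    "((\<lambda>x. torus_normal x $ 3) has_derivative (\<lambda>h. ?D h $ 3)) (at x)"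
    unfolding torus_normal_def vector_3
    by (auto intro!: derivative_eq_intros simp: fun_eq_iff algebra_simps)
  then have "((\<lambda>x. torus_normal x $ i) has_derivative (\<lambda>h. ?D h $ i)) (at x)" for i
    using exhaust_3[of i] by (elim disjE) (simp_all only:)
  then have "(torus_normal has_derivative ?D) (at x)"
    by (rule has_derivative_vec_componentwise)
  from fun_cong[OF frechet_derivative_at[OF this], of h] show ?thesis by (rule sym)
qed

lemma sum_Basis_real3:
  fixes f :: "real^3 \<Rightarrow> real"
  shows "(\<Sum>b\<in>Basis. f b) = f (axis 1 1) + f (axis 2 1) + f (axis 3 1)"
proof -
  have "(Basis :: (real^3) set) = (\<lambda>i::3. axis i 1) ` UNIV" by (auto simp: Basis_vec_def)
  moreover have "inj (\<lambda>i::3. axis i (1::real))" by (auto simp: inj_on_def axis_eq_axis)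
  ultimately have "sum f Basis = sum (f \<circ> (\<lambda>i::3. axis i 1)) UNIV"
    using sum.reindex[of "\<lambda>i::3. axis i (1::real)" UNIV f] by simp
  then show ?thesis by (simp add: sum_3)
qed

lemma inner_real3: "(x::real^3) \<bullet> y = x $ 1 * y $ 1 + x $ 2 * y $ 2 + x $ 3 * y $ 3"
  by (simp add: inner_vec_def sum_3)

lemma norm_meridian_squared: "norm (meridian x) ^ 2 = (radial x - 2)^2 + (x $ 3)^2"
  by (simp add: meridian_def cmod_power2)

lemma torus_normal_unit:
  assumes "norm (meridian x) = 1"
  shows "torus_normal x \<bullet> torus_normal x = 1"
proof -
  define i where "i = inverse (radial x)"
  have "radial x * i = 1" using one_le_radial[of x] assms by (simp add: i_def)
  moreover have "1 = (radial x - 2)^2 + (x $ 3)^2" using norm_meridian_squared[of x] assms by simp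
  moreover have "radial x ^ 2 = (x $ 1)^2 + (x $ 2)^2" by (rule radial_squared)
  ultimately have "((2 * i - 1) * x $ 1) * ((2 * i - 1) * x $ 1) + ((2 * i - 1) * x $ 2) * ((2 * i - 1) * x $ 2)
      + (- x $ 3) * (- x $ 3) = 1"
    by algebra
  then show ?thesis by (simp add: inner_real3 torus_normal_def i_def)
qed

text \<open>The full trace of the derivative is \<open>2 * inverse (radial p) - 3\<close>. The
  normal direction contributes -1 to it, since a step towards the core shortens the vector to the
  core by that step. The tangent plane is left with \<open>2 * inverse (radial p) - 2\<close>, and
  half its negative is the curvature.\<close>

lemma mean_curvature_torus:
  assumes p: "norm (meridian p) = 1"
  shows "mean_curvature torus_normal p = 1 - inverse (radial p)"
proof -
  define i where "i = inverse (radial p)"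
  have r: "0 < radial p" using one_le_radial[of p] p by simp
  then have ri: "radial p * i = 1" by (simp add: i_def)
  have rr: "radial p ^ 2 = (p $ 1)^2 + (p $ 2)^2" by (rule radial_squared)
  have "(\<Sum>b\<in>Basis. frechet_derivative torus_normal (at p) b \<bullet> b) =
      2 * (2 * i - 1) - 2 * ((p $ 1)^2 + (p $ 2)^2) * i^3 - 1"
    unfolding sum_Basis_real3 frechet_derivative_torus_normal[OF r] inner_real3
    by (simp add: axis_def i_def algebra_simps power2_eq_square)
  also have "\<dots> = 2 * i - 3" using ri unfolding rr[symmetric] by algebra
  finally have tr: "(\<Sum>b\<in>Basis. frechet_derivative torus_normal (at p) b \<bullet> b) = 2 * i - 3" .
  have "frechet_derivative torus_normal (at p) (torus_normal p) = - torus_normal p"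
  proof -
    define t where "t = 2 * i - 1"
    have h: "t * (t * y) - 2 * (p $ 1 * (t * p $ 1) + p $ 2 * (t * p $ 2)) * i^3 * y = - (t * y)" for y
      using ri rr unfolding t_def by algebra
    show ?thesis
      unfolding frechet_derivative_torus_normal[OF r]
      using h[of "p $ 1"] h[of "p $ 2"]
      by (simp add: torus_normal_def vec_eq_iff forall_3 flip: i_def t_def)
  qed
  then have "frechet_derivative torus_normal (at p) (torus_normal p) \<bullet> torus_normal p = - 1"
    using torus_normal_unit[OF p] by simp
  then show ?thesis unfolding mean_curvature_def tr by (simp add: i_def field_simps)
qed

lemma tangent_vectors_torus:
  assumes x: "norm (meridian x) = 1" and v: "v \<in> tangent_vectors (frontier solid_torus) x"
  shows "torus_normal x \<bullet> v = 0"
proof -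
  obtain \<gamma> e where e: "e > 0" "\<And>t. \<bar>t\<bar> < e \<Longrightarrow> norm (meridian (\<gamma> t)) = 1" "\<gamma> 0 = x"
    and d: "(\<gamma> has_vector_derivative v) (at 0)"
    using v by (auto simp: tangent_vectors_def frontier_solid_torus)
  have r: "0 < radial x" using one_le_radial[of x] x by simp
  \<comment> \<open>\<open>F y\<close> is \<open>norm (meridian y) ^ 2 - 4\<close>. Its gradient at
    \<open>x\<close> is -2 times \<open>torus_normal x\<close>, and it is constantly -3 along a
    curve in the boundary, so the velocity is orthogonal to the normal.\<close>
  define F where "F y = (y $ 1)^2 + (y $ 2)^2 + (y $ 3)^2 - 4 * radial y" for y :: "real^3"
  note [derivative_intros] = has_derivative_radial[OF r]
  have "(F has_derivative (\<lambda>h. - 2 * (torus_normal x \<bullet> h))) (at x)"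
    unfolding F_def[abs_def]
    by (auto intro!: derivative_eq_intros simp: fun_eq_iff inner_real3 torus_normal_def algebra_simps)
  then have "((F \<circ> \<gamma>) has_derivative ((\<lambda>h. - 2 * (torus_normal x \<bullet> h)) \<circ> (\<lambda>t. t *\<^sub>R v))) (at 0)"
    using d e(3) unfolding has_vector_derivative_def by (intro diff_chain_at) auto
  moreover have "((F \<circ> \<gamma>) has_derivative (\<lambda>t. 0)) (at 0)"
  proof (rule has_derivative_transform_within_open[of "\<lambda>t. -3" _ _ _ "ball 0 e"])
    show "- 3 = (F \<circ> \<gamma>) t" if "t \<in> ball 0 e" for t
    proof -
      have "norm (meridian (\<gamma> t)) = 1" using e(2) that by (simp add: dist_norm)
      then have "1 = (radial (\<gamma> t) - 2)^2 + (\<gamma> t $ 3)^2" using norm_meridian_squared[of "\<gamma> t"] by simp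
      then show ?thesis using radial_squared[of "\<gamma> t"] unfolding F_def comp_def by algebra
    qed
  qed (use e in auto)
  ultimately have "(\<lambda>h. - 2 * (torus_normal x \<bullet> h)) \<circ> (\<lambda>t. t *\<^sub>R v) = (\<lambda>t. 0)"
    by (rule has_derivative_unique)
  from fun_cong[OF this, of 1] show ?thesis by simp
qed

text \<open>A step of length \<open>t\<close> towards the core multiplies the cross-section
  coordinate by \<open>1 - t\<close>. The factor \<open>c\<close> on the horizontal part has to be
  positive for \<open>radial\<close> to scale by \<open>c\<close> too.\<close>

lemma torus_normal_inward:
  assumes x: "norm (meridian x) = 1" and t: "0 < t" "t < 1"
  shows "x + t *\<^sub>R torus_normal x \<in> interior solid_torus"
proof -
  define r y where "r = radial x" and "y = x + t *\<^sub>R torus_normal x"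
  define c where "c = 1 + t * (2 * inverse r - 1)"
  have r: "1 \<le> r" using one_le_radial[of x] x by (simp add: r_def)
  have c: "0 < c"
  proof -
    have "0 < 2 * inverse r * t + (1 - t)" using r t by (intro add_pos_pos mult_pos_pos) auto
    then show ?thesis by (simp add: c_def algebra_simps)
  qed
  have "y $ 1 = c * x $ 1" "y $ 2 = c * x $ 2" and y3: "y $ 3 = (1 - t) * x $ 3"
    by (simp_all add: y_def torus_normal_def c_def r_def algebra_simps)
  then have "planar y = of_real c * planar x" by (simp add: planar_def complex_eq_iff)
  then have "radial y = c * r" using c by (simp add: radial_def norm_mult r_def)
  moreover have "inverse r * r = 1" using r by simp
  ultimately have "radial y - 2 = (1 - t) * (r - 2)" unfolding c_def by algebra
  then have "meridian y = of_real (1 - t) * meridian x"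
    using y3 by (simp add: meridian_def complex_eq_iff r_def)
  then have "norm (meridian y) = 1 - t" using x t by (simp add: norm_mult del: of_real_diff)
  then show ?thesis using t by (simp add: interior_solid_torus y_def)
qed

text \<open>The boundary is a single face. Being a closed surface, it has empty relative frontier,
  hence no edges, and it serves as its own extension inside the ambient region
  \<open>UNIV\<close>.\<close>

lemma mean_convex_solid_torus: "mean_convex_domain solid_torus"
proof -
  let ?F = "frontier solid_torus"
  have ne: "?F \<noteq> {}"
  proof -
    have "vector [3, 0, 0] \<in> ?F"
      by (simp add: frontier_solid_torus meridian_def radial_def planar_def cmod_def)
    then show ?thesis by blast
  qed
  have whole: "top_of_set ?F interior_of ?F = ?F" "top_of_set ?F frontier_of ?F = {}"
    using interior_of_topspace[of "top_of_set ?F"] frontier_of_topspace[of "top_of_set ?F"] by simp_all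
  have "piecewise_smooth_boundary solid_torus {?F}"
    unfolding piecewise_smooth_boundary_def
    using ne smooth_surface_frontier_solid_torus frontier_solid_torus_locally_modelled
      connected_frontier_solid_torus compact_frontier[OF compact_solid_torus]
    by (auto simp: whole intro: exI[of _ "{}"])
  moreover have "nonneg_mean_curvature solid_torus ?F"
    unfolding nonneg_mean_curvature_def Let_def whole
  proof
    fix p assume "p \<in> ?F"
    then have p: "norm (meridian p) = 1" by (simp add: frontier_solid_torus)
    then have r: "1 \<le> radial p" by (intro one_le_radial) simp
    have "inward_unit_normal solid_torus ?F {x. 0 < radial x} torus_normal"
      unfolding inward_unit_normal_def
    proof (intro conjI ballI open_radial_pos smooth_on_torus_normal)
      fix x assume "x \<in> ?F \<inter> {x. 0 < radial x}"
      then have x: "norm (meridian x) = 1" by (simp add: frontier_solid_torus)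
      show "norm (torus_normal x) = 1" using torus_normal_unit[OF x] by (simp add: norm_eq_1)
      show "torus_normal x \<bullet> v = 0" if "v \<in> tangent_vectors ?F x" for v
        using x that by (rule tangent_vectors_torus)
      show "\<exists>e>0. \<forall>t. 0 < t \<and> t < e \<longrightarrow> x + t *\<^sub>R torus_normal x \<in> interior solid_torus"
        using torus_normal_inward[OF x] by (intro exI[of _ 1]) auto
    qed
    moreover have "0 \<le> mean_curvature torus_normal p"
      using r by (simp add: mean_curvature_torus[OF p] inverse_le_1_iff)
    ultimately show "\<exists>U \<nu>. p \<in> U \<and> inward_unit_normal solid_torus ?F U \<nu> \<and> 0 \<le> mean_curvature \<nu> p"
      using r by (intro exI[of _ "{x. 0 < radial x}"] exI[of _ torus_normal]) auto
  qed
  moreover have "?F \<inter> solid_torus = ?F"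
    using frontier_subset_closed[OF closed_solid_torus] by blast
  ultimately show ?thesis
    unfolding mean_convex_domain_def
    using compact_domain_solid_torus smooth_surface_frontier_solid_torus
    by (intro conjI exI[of _ "{?F}"] exI[of _ UNIV]) auto
qed

section \<open>The covering space of cubics with a chosen root\<close>

text \<open>Local injectivity gives open images by invariance of domain. Over a small neighbourhood
  of \<open>y\<close>, the \<open>n\<close> disjoint sheets around the fibre already supply
  \<open>n\<close> preimages of each point, so there are no others and the neighbourhood is evenly
  covered.\<close>

lemma covering_space_equinumerous_fibres:
  fixes p :: "'a::euclidean_space \<Rightarrow> 'b::euclidean_space"
  assumes C: "open C" and p: "continuous_on C p" "p ` C = S" and dim: "DIM('b) \<le> DIM('a)"
    and inj: "\<And>x. x \<in> C \<Longrightarrow> \<exists>U. open U \<and> x \<in> U \<and> U \<subseteq> C \<and> inj_on p U"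
    and fib: "\<And>y. y \<in> S \<Longrightarrow> finite (C \<inter> p -` {y})"
    and card: "\<And>y. y \<in> S \<Longrightarrow> card (C \<inter> p -` {y}) = n"
  shows "covering_space C p S"
  unfolding covering_space_def
proof (intro conjI ballI)
  fix y assume y: "y \<in> S"
  define F where "F = C \<inter> p -` {y}"
  have F: "finite F" "card F = n" "F \<subseteq> C" "\<And>x. x \<in> F \<Longrightarrow> p x = y" "F \<noteq> {}"
    using fib[OF y] card[OF y] y p(2) by (auto simp: F_def)
  have "\<forall>x\<in>F. \<exists>U. open U \<and> x \<in> U \<and> U \<subseteq> C \<and> inj_on p U"
    using inj F by blast
  then obtain U where U: "\<And>x. x \<in> F \<Longrightarrow> open (U x) \<and> x \<in> U x \<and> U x \<subseteq> C \<and> inj_on p (U x)"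
    by metis
  have "\<forall>x\<in>F. \<exists>d>0. \<forall>z\<in>F. z \<noteq> x \<longrightarrow> d \<le> dist x z"
    using finite_set_avoid[OF F(1)] by blast
  then obtain d where d: "\<And>x. x \<in> F \<Longrightarrow> d x > 0 \<and> (\<forall>z\<in>F. z \<noteq> x \<longrightarrow> d x \<le> dist x z)"
    by metis
  \<comment> \<open>Half the distance to the other points of the fibre makes the sheets
    disjoint.\<close>
  define V where "V x = U x \<inter> ball x (d x / 2)" for x
  have V: "open (V x)" "x \<in> V x" "V x \<subseteq> C" "inj_on p (V x)" if "x \<in> F" for x
    using U[OF that] d[OF that] by (auto simp: V_def inj_on_def)
  have disj: "V x \<inter> V z = {}" if "x \<in> F" "z \<in> F" "x \<noteq> z" for x z
  proof -
    have "dist x z < d x / 2 + d z / 2" if "u \<in> V x" "u \<in> V z" for u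
      using that dist_triangle[of x z u] by (auto simp: V_def dist_commute)
    moreover have "d x \<le> dist x z" "d z \<le> dist x z"
      using d[OF that(1)] d[OF that(2)] that by (auto simp: dist_commute)
    ultimately show ?thesis by fastforce
  qed
  define T where "T = (\<Inter>x\<in>F. p ` V x)"
  have opV: "open (p ` W)" if "x \<in> F" "open W" "W \<subseteq> V x" for x W
    by (rule invariance_of_domain_gen[OF \<open>open W\<close> _ _ dim])
       (use that V[OF that(1)] p(1) in \<open>auto intro: continuous_on_subset inj_on_subset\<close>)
  have "open T" unfolding T_def using F opV V by (intro open_INT) blast+
  have "y \<in> T" using F V unfolding T_def by blast
  have "T \<subseteq> S"
  proof -
    obtain x where x: "x \<in> F" using F(5) by blast
    have "T \<subseteq> p ` V x" unfolding T_def using x by auto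
    also have "\<dots> \<subseteq> p ` C" by (intro image_mono V x)
    finally show ?thesis using p by simp
  qed
  define v where "v = (\<lambda>x. V x \<inter> p -` T) ` F"
  have opv: "open (V x \<inter> p -` T)" if "x \<in> F" for x
    using continuous_open_preimage[OF continuous_on_subset[OF p(1) V(3)[OF that]] V(1)[OF that] \<open>open T\<close>] .
  \<comment> \<open>One preimage of \<open>p c\<close> from each sheet gives \<open>n\<close>
    distinct ones, hence the full fibre; so \<open>c\<close> itself lies in a sheet.\<close>
  have cover: "c \<in> \<Union>v" if c: "c \<in> C" "p c \<in> T" for c
  proof -
    have "\<forall>x\<in>F. \<exists>q. q \<in> V x \<and> p q = p c" using c unfolding T_def by force
    then obtain q where q: "\<And>x. x \<in> F \<Longrightarrow> q x \<in> V x \<and> p (q x) = p c" by metis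
    have "inj_on q F" using q disj unfolding inj_on_def by (metis IntI empty_iff)
    then have "card (q ` F) = n" using F by (simp add: card_image)
    moreover have "q ` F \<subseteq> C \<inter> p -` {p c}" using q V by fastforce
    moreover have "p c \<in> S" using c p by blast
    ultimately have "q ` F = C \<inter> p -` {p c}"
      using fib card by (metis card_subset_eq)
    then have "c \<in> q ` F" using c by blast
    then show ?thesis using q c by (auto simp: v_def)
  qed
  show "\<exists>T. y \<in> T \<and> openin (top_of_set S) T \<and> (\<exists>v. \<Union> v = C \<inter> p -` T \<and>
      (\<forall>u\<in>v. openin (top_of_set C) u) \<and> pairwise disjnt v \<and> (\<forall>u\<in>v. \<exists>q. homeomorphism u T p q))"
  proof (intro exI[of _ T] exI[of _ v] conjI ballI)
    show "openin (top_of_set S) T"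
      using \<open>open T\<close> \<open>T \<subseteq> S\<close> by (rule open_subset[rotated])
    show "\<Union> v = C \<inter> p -` T"
      using cover V(3) unfolding v_def by blast
    show "openin (top_of_set C) u" if "u \<in> v" for u
      using that opv V(3) unfolding v_def by (blast intro: open_subset)
    show "pairwise disjnt v"
      using disj by (fastforce simp: v_def pairwise_def disjnt_def)
    show "\<exists>q. homeomorphism u T p q" if u: "u \<in> v" for u
    proof -
      obtain x where x: "x \<in> F" "u = V x \<inter> p -` T" using u unfolding v_def by blast
      have "T \<subseteq> p ` V x" using x(1) unfolding T_def by blast
      then have "p ` u = T" unfolding x(2) by blast
      moreover obtain q where "homeomorphism u (p ` u) p q"
        by (rule invariance_of_domain_homeomorphism[of u p])
           (use x opv V[OF x(1)] p(1) dim in \<open>auto intro: continuous_on_subset inj_on_subset\<close>)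
      ultimately show ?thesis by auto
    qed
  qed (use \<open>y \<in> T\<close> in auto)
qed (use p in auto)

section \<open>Depressed cubics, their discriminant and the choice of a root\<close>

lemma depressed_cubic_splits:
  fixes z w :: complex
  obtains a b c where "a + b + c = 0" "a*b + b*c + c*a = -3*w" "a*b*c = 2*z"
    "\<And>t. t^3 - 3*w*t - 2*z = (t - a) * (t - b) * (t - c)"
proof -
  have "\<exists>a. poly [:-2*z, -3*w, 0, 1:] a = 0"
    by (rule fundamental_theorem_of_algebra_alt) simp
  then obtain a where "poly [:-2*z, -3*w, 0, 1:] a = 0" ..
  then have a: "a^3 - 3*w*a = 2*z" by (simp add: power3_eq_cube algebra_simps)
  \<comment> \<open>The radicand is the discriminant of \<open>t^2 + a*t + a^2 - 3*w\<close>, the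
    quadratic left after dividing the cubic by \<open>t - a\<close>.\<close>
  define s where "s = csqrt (12*w - 3*a^2)"
  have s: "s^2 = 12*w - 3*a^2" by (simp add: s_def)
  define b c where "b = (-a + s) / 2" and "c = (-a - s) / 2"
  have "b + c = -a" by (simp add: b_def c_def field_simps)
  moreover have "b * c = (a^2 - s^2) / 4"
    by (simp add: b_def c_def field_simps power2_eq_square)
  then have "b * c = a^2 - 3*w" by (simp add: s diff_divide_distrib)
  ultimately have *: "a + b + c = 0" "a*b + b*c + c*a = -3*w" "a*b*c = 2*z"
    using a by algebra+
  then have "t^3 - 3*w*t - 2*z = (t - a) * (t - b) * (t - c)" for t
    by algebra
  with * show thesis by (rule that)
qed

text \<open>The cubic is linear in \<open>z\<close>, so a cubic with a chosen root is the same as a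
  pair \<open>(w, t)\<close>; the map recovers \<open>(z, w)\<close> and forgets the root.\<close>

definition cubic_root_map :: "complex \<times> complex \<Rightarrow> complex \<times> complex" where
  "cubic_root_map = (\<lambda>(w, t). ((t^3 - 3*w*t) / 2, w))"

text \<open>\<open>t^2 \<noteq> w\<close> says that \<open>t\<close> is a simple root,
  \<open>t^2 \<noteq> 4*w\<close> that the other two roots differ. Together they say that the
  discriminant does not vanish, and then each fibre has three points.\<close>

lemma covering_space_cubic_root_map:
  "covering_space {(w, t). t^2 \<noteq> w \<and> t^2 \<noteq> 4*w} cubic_root_map {(z, w). z^2 \<noteq> w^3}"
    (is "covering_space ?C _ ?S")
proof (rule covering_space_equinumerous_fibres)
  \<comment> \<open>Expressing \<open>z\<close> through \<open>w\<close> and the root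
    \<open>t\<close> makes the discriminant factor, which matches the loci removed upstairs and
    downstairs.\<close>
  have disc: "4 * (((t^3 - 3*w*t) / 2)^2 - w^3) = (t^2 - w)^2 * (t^2 - 4*w)" for t w :: complex
    by (simp add: field_simps) algebra
  have disc': "((t^3 - 3*w*t) / 2)^2 = w^3 \<longleftrightarrow> t^2 = w \<or> t^2 = 4*w" for t w :: complex
  proof -
    have "((t^3 - 3*w*t) / 2)^2 = w^3 \<longleftrightarrow> 4 * (((t^3 - 3*w*t) / 2)^2 - w^3) = 0" by simp
    then show ?thesis unfolding disc by simp
  qed
  have fibre: "?C \<inter> cubic_root_map -` {(z, w)} = Pair w ` {t. t^3 - 3*w*t - 2*z = 0}"
    if "z^2 \<noteq> w^3" for z w
  proof -
    have "(w', t) \<in> ?C \<inter> cubic_root_map -` {(z, w)} \<longleftrightarrow> w' = w \<and> t^3 - 3*w*t - 2*z = 0" for w' t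
    proof -
      have *: "(t^3 - 3*w*t) / 2 = z \<longleftrightarrow> t^3 - 3*w*t - 2*z = 0"
        by (auto simp: field_simps)
      show ?thesis unfolding *[symmetric] using that disc'[of t w]
        by (auto simp: cubic_root_map_def)
    qed
    then show ?thesis by auto
  qed
  have roots: "finite {t. t^3 - 3*w*t - 2*z = 0}" "card {t. t^3 - 3*w*t - 2*z = 0} = 3"
    if zw: "z^2 \<noteq> w^3" for z w :: complex
  proof -
    obtain a b c where e: "a + b + c = 0" "a*b + b*c + c*a = -3*w" "a*b*c = 2*z"
      and abc: "\<And>t. t^3 - 3*w*t - 2*z = (t - a) * (t - b) * (t - c)"
      using depressed_cubic_splits by blast
    \<comment> \<open>Up to sign both sides are the discriminant of the cubic, so
      \<open>z^2 \<noteq> w^3\<close> forces distinct roots.\<close>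
    from e have *: "4 * 27 * (z^2 - w^3) = - (((a-b)*(b-c)*(c-a))^2)"
      by algebra
    have "a \<noteq> b" "b \<noteq> c" "c \<noteq> a"
      using zw * by auto
    moreover have "{t. t^3 - 3*w*t - 2*z = 0} = {a, b, c}"
      unfolding abc by auto
    ultimately show "finite {t. t^3 - 3*w*t - 2*z = 0}" "card {t. t^3 - 3*w*t - 2*z = 0} = 3"
      by auto
  qed
  show "open ?C"
    by (simp add: case_prod_unfold) (intro open_Collect_conj open_Collect_neq continuous_intros)
  show "continuous_on ?C cubic_root_map"
    unfolding cubic_root_map_def case_prod_unfold by (intro continuous_intros) auto
  show fin: "finite (?C \<inter> cubic_root_map -` {y})" and card: "card (?C \<inter> cubic_root_map -` {y}) = 3"
    if "y \<in> ?S" for y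
    using that roots fibre by (auto simp: card_image inj_on_def)
  show "cubic_root_map ` ?C = ?S"
  proof (intro equalityI subsetI)
    fix y assume y: "y \<in> ?S"
    have "?C \<inter> cubic_root_map -` {y} \<noteq> {}"
    proof
      assume "?C \<inter> cubic_root_map -` {y} = {}"
      with card[OF y] show False by simp
    qed
    then show "y \<in> cubic_root_map ` ?C" by blast
  next
    fix y assume "y \<in> cubic_root_map ` ?C"
    then obtain w t where "t^2 \<noteq> w" "t^2 \<noteq> 4*w" "y = cubic_root_map (w, t)" by blast
    then show "y \<in> ?S"
      using disc'[of t w] by (simp add: cubic_root_map_def)
  qed
  show "\<exists>U. open U \<and> x \<in> U \<and> U \<subseteq> ?C \<and> inj_on cubic_root_map U" if x: "x \<in> ?C" for x
  proof -
    \<comment> \<open>For equal \<open>w\<close> this is the divided difference of the cubic in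
      \<open>t\<close>. On the diagonal it is \<open>3 * (t^2 - w)\<close>, which is nonzero, and by
      continuity it stays nonzero on pairs of nearby points, so the map is injective there.\<close>
    define g :: "(complex \<times> complex) \<times> (complex \<times> complex) \<Rightarrow> complex"
      where "g = (\<lambda>((w, t), (w', t')). t^2 + t*t' + t'^2 - 3*w)"
    have "open {y. g y \<noteq> 0}"
      unfolding g_def case_prod_unfold by (intro open_Collect_neq continuous_intros)
    moreover have "(x, x) \<in> {y. g y \<noteq> 0}"
      using x by (auto simp: g_def power2_eq_square)
    ultimately obtain A B where AB: "open A" "open B" "(x, x) \<in> A \<times> B" "A \<times> B \<subseteq> {y. g y \<noteq> 0}"
      by (rule open_prod_elim)
    have "inj_on cubic_root_map (A \<inter> B \<inter> ?C)"
    proof (rule inj_onI)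
      fix p q assume p: "p \<in> A \<inter> B \<inter> ?C" and q: "q \<in> A \<inter> B \<inter> ?C"
        and eq: "cubic_root_map p = cubic_root_map q"
      obtain w t t' where wt: "p = (w, t)" "q = (w, t')" "t^3 * 2 - 6*(w*t) = t'^3 * 2 - 6*(w*t')"
        using eq by (cases p; cases q) (auto simp: cubic_root_map_def)
      have "g (p, q) \<noteq> 0" using p q AB by blast
      moreover have "2 * ((t - t') * g (p, q)) = 0"
        using wt(3) unfolding wt(1,2) g_def by simp algebra
      ultimately show "p = q" using wt by simp
    qed
    then show ?thesis
      using AB x \<open>open ?C\<close> by (intro exI[of _ "A \<inter> B \<inter> ?C"]) auto
  qed
qed simp

section \<open>Disks bounded by the trefoil\<close>

text \<open>A root satisfies
  \<open>(t - 2*T) * (t + T)^2 = 3 * (w - T^2) * t + 2 * (z - T^3)\<close>. As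
  \<open>norm t \<le> 3\<close>, the right side has norm at most 11/1000, below 1/64, so
  \<open>t - 2*T\<close> or \<open>t + T\<close> has norm less than 1/4.\<close>

lemma cubic_root_dichotomy:
  fixes t w z T :: complex
  assumes t: "t^3 - 3*w*t - 2*z = 0" and T: "norm T = 1"
    and z: "norm (z - T^3) < 1/1000" and w: "norm (w - T^2) < 1/1000"
  shows "norm (t - 2*T) < 1/4 \<or> norm (t + T) < 1/4"
proof -
  have nw: "norm w \<le> 1001/1000"
    using norm_triangle_ineq[of "w - T^2" "T^2"] w T by (simp add: norm_power)
  have nz: "norm z \<le> 1001/1000"
    using norm_triangle_ineq[of "z - T^3" "T^3"] z T by (simp add: norm_power)
  have t3: "norm t \<le> 3"
  proof (rule ccontr)
    assume "\<not> ?thesis"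
    then have gt: "norm t > 3" by simp
    have "t^3 = 3*w*t + 2*z" using t by algebra
    then have "norm t ^ 3 \<le> 3 * norm w * norm t + 2 * norm z"
      using norm_triangle_ineq[of "3*w*t" "2*z"] by (simp add: norm_power[symmetric] norm_mult)
    also have "\<dots> \<le> 3 * (1001/1000) * norm t + 2 * (1001/1000)"
      using nw nz by (intro add_mono mult_mono) auto
    also have "\<dots> < 9 * norm t" using gt by simp
    also have "\<dots> \<le> norm t ^ 2 * norm t"
      using gt power_mono[of 3 "norm t" 2] by (intro mult_right_mono) auto
    finally show False by (simp add: power2_eq_square power3_eq_cube)
  qed
  have "(t - 2*T) * (t + T)^2 = 3 * (w - T^2) * t + 2 * (z - T^3)"
    using t by algebra
  then have "norm ((t - 2*T) * (t + T)^2) \<le> norm (3 * (w - T^2) * t) + norm (2 * (z - T^3))"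
    by (simp only: norm_triangle_ineq)
  also have "\<dots> = 3 * norm (w - T^2) * norm t + 2 * norm (z - T^3)"
    by (simp only: norm_mult norm_numeral)
  also have "\<dots> \<le> 3 * (1/1000) * 3 + 2 * (1/1000)"
    using z w t3 by (intro add_mono mult_mono) auto
  also have "\<dots> < (1/4) * (1/4)^2" by (simp add: power2_eq_square)
  finally have "norm (t - 2*T) * norm (t + T)^2 < (1/4) * (1/4)^2"
    by (simp add: norm_mult norm_power)
  moreover have "(1/4) * (1/4)^2 \<le> norm (t - 2*T) * norm (t + T)^2"
    if "1/4 \<le> norm (t - 2*T)" "1/4 \<le> norm (t + T)"
    using that by (intro mult_mono power_mono) auto
  ultimately show ?thesis by linarith
qed

lemma cubic_root_near_double:
  fixes w z T :: complex
  assumes T: "norm T = 1"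
    and z: "norm (z - T^3) < 1/1000" and w: "norm (w - T^2) < 1/1000"
  obtains t where "t^3 - 3*w*t - 2*z = 0" "norm (t - 2*T) < 1/4"
proof -
  obtain a b c where sum: "a + b + c = 0"
    and abc: "\<And>t. t^3 - 3*w*t - 2*z = (t - a) * (t - b) * (t - c)"
    using depressed_cubic_splits by blast
  have roots: "a^3 - 3*w*a - 2*z = 0" "b^3 - 3*w*b - 2*z = 0" "c^3 - 3*w*c - 2*z = 0"
    unfolding abc by auto
  \<comment> \<open>The three roots sum to 0, so they cannot all be close to \<open>-T\<close>.\<close>
  have "3*T = (a + T) + (b + T) + (c + T)" using sum by algebra
  then have "norm (a + T + (b + T) + (c + T)) = 3"
    using T by (metis norm_mult norm_numeral mult_1_right)
  then have "3 \<le> norm (a + T) + norm (b + T) + norm (c + T)"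
    using norm_triangle_ineq[of "a + T + (b + T)" "c + T"] norm_triangle_ineq[of "a + T" "b + T"]
    by linarith
  then have "\<not> norm (a + T) < 1/4 \<or> \<not> norm (b + T) < 1/4 \<or> \<not> norm (c + T) < 1/4" by argo
  then show ?thesis
    using roots[THEN cubic_root_dichotomy, OF T z w] roots that by blast
qed

text \<open>The imaginary part of \<open>m\<close> at \<open>x\<close> minus that at
  \<open>- x\<close> is an odd function on a connected sphere, hence vanishes somewhere. The real
  parts agree there because \<open>norm (T x) = 1\<close>, so \<open>T\<close> identifies two
  antipodal points.\<close>

lemma sphere_no_injective_logarithm:
  fixes T m :: "'a::euclidean_space \<Rightarrow> complex"
  assumes dim: "2 \<le> DIM('a)" and m: "continuous_on (sphere 0 1) m"
    and T: "\<And>x. x \<in> sphere 0 1 \<Longrightarrow> norm (T x) = 1 \<and> T x = c * exp (m x)"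
    and inj: "inj_on T (sphere 0 1)"
  shows False
proof -
  define g where "g x = Im (m x) - Im (m (- x))" for x
  have cont: "continuous_on (sphere 0 1) g"
    unfolding g_def by (intro continuous_intros m continuous_on_compose2[OF m]) auto
  have conn: "connected (g ` sphere 0 1)"
    using dim by (intro connected_continuous_image cont connected_sphere) auto
  obtain b :: 'a where b: "b \<in> Basis" using nonempty_Basis by blast
  have "g (- b) = - g b" by (simp add: g_def)
  moreover have "g b \<in> g ` sphere 0 1" "g (- b) \<in> g ` sphere 0 1" using b by auto
  ultimately have "0 \<in> g ` sphere 0 1"
    using conn connectedD_interval[of "g ` sphere 0 1" "g b" "- g b" 0]
      connectedD_interval[of "g ` sphere 0 1" "- g b" "g b" 0] by (cases "g b \<le> 0") auto
  then obtain x where x: "x \<in> sphere 0 1" "g x = 0" by auto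
  have x': "- x \<in> sphere 0 1" using x by simp
  have "c \<noteq> 0" using T[OF x(1)] by (metis mult_zero_left norm_zero zero_neq_one)
  moreover have "norm c * exp (Re (m x)) = norm c * exp (Re (m (-x)))"
    using T[OF x(1)] T[OF x'] by (metis norm_mult norm_exp_eq_Re)
  ultimately have "exp (Re (m x)) = exp (Re (m (-x)))" by (simp only: mult_cancel_left norm_eq_zero) blast
  then have "Re (m x) = Re (m (-x))" by (simp only: exp_inj_iff)
  then have "m x = m (- x)" using x(2) by (simp add: g_def complex_eq_iff)
  then have "T x = T (- x)" using T[OF x(1)] T[OF x'] by simp
  then have "x = - x" using inj x x' by (auto dest: inj_onD)
  then have "2 *\<^sub>R x = 0" by (simp only: eq_neg_iff_add_eq_0 scaleR_2)
  then have "x = 0" by simp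
  then show False using x by simp
qed

text \<open>The topological core, phrased through two complex functions only. Simple connectedness
  of the ball yields a continuous root; connectedness of the sphere keeps it near
  \<open>2 * T x\<close>.\<close>

lemma no_disk_spans_cuspidal_curve:
  fixes z w :: "'a::euclidean_space \<Rightarrow> complex"
  assumes dim: "2 \<le> DIM('a)"
    and z: "continuous_on (cball 0 1) z" and w: "continuous_on (cball 0 1) w"
    and bdry: "\<And>x. norm x = 1 \<Longrightarrow> z x ^ 2 = w x ^ 3 \<and> norm (w x) = 1"
    and int: "\<And>x. norm x < 1 \<Longrightarrow> z x ^ 2 \<noteq> w x ^ 3"
    and inj: "inj_on (\<lambda>x. (z x, w x)) (sphere 0 1)"
  shows False
proof -
  \<comment> \<open>The inverse of the cusp parametrization \<open>(T^3, T^2)\<close>; it is used on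
    the sphere, where \<open>w\<close> has norm 1.\<close>
  define T where "T x = z x / w x" for x
  have wnz: "w x \<noteq> 0" if "x \<in> sphere 0 1" for x using bdry[of x] that by auto
  have T: "T x ^ 2 = w x" "T x ^ 3 = z x" "norm (T x) = 1" if "x \<in> sphere 0 1" for x
  proof -
    have zw: "z x ^ 2 = w x ^ 3" "norm (w x) = 1" "w x \<noteq> 0" using bdry[of x] that by auto
    then show "T x ^ 2 = w x" by (simp add: T_def power_divide power2_eq_square power3_eq_cube)
    then have "norm (T x) ^ 2 = 1" using zw by (simp flip: norm_power)
    then show "norm (T x) = 1" by (simp add: power2_eq_1_iff) (metis norm_ge_zero not_one_le_zero neg_0_le_iff_le)
    have "T x ^ 3 = T x ^ 2 * T x" by (simp add: power2_eq_square power3_eq_cube)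
    then show "T x ^ 3 = z x" using \<open>T x ^ 2 = w x\<close> zw by (simp add: T_def)
  qed
  have contT: "continuous_on (sphere 0 1) T"
    unfolding T_def using wnz z w by (intro continuous_intros) (auto intro: continuous_on_subset)
  have injT: "inj_on T (sphere 0 1)"
    using inj T unfolding inj_on_def by (metis prod.inject)
  obtain r where r: "0 < r" "r < 1" and
    near: "\<And>x. x \<in> sphere 0 1 \<Longrightarrow> norm (z (r *\<^sub>R x) - T x ^ 3) < 1/1000 \<and> norm (w (r *\<^sub>R x) - T x ^ 2) < 1/1000"
  proof -
    have u: "uniformly_continuous_on (cball 0 1) z" "uniformly_continuous_on (cball 0 1) w"
      using z w by (auto intro: compact_uniformly_continuous)
    obtain d1 where d1: "d1 > 0" "\<And>x y. x \<in> cball 0 1 \<Longrightarrow> y \<in> cball 0 1 \<Longrightarrow> dist y x < d1 \<Longrightarrow> dist (z y) (z x) < 1/1000"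
      using u(1) unfolding uniformly_continuous_on_def by (metis zero_less_divide_1_iff zero_less_numeral)
    obtain d2 where d2: "d2 > 0" "\<And>x y. x \<in> cball 0 1 \<Longrightarrow> y \<in> cball 0 1 \<Longrightarrow> dist y x < d2 \<Longrightarrow> dist (w y) (w x) < 1/1000"
      using u(2) unfolding uniformly_continuous_on_def by (metis zero_less_divide_1_iff zero_less_numeral)
    \<comment> \<open>Moving inward by \<open>e\<close> along a radius displaces a boundary point by
      exactly \<open>e\<close>, which is below both moduli of continuity.\<close>
    define e where "e = min (1/2) (min d1 d2 / 2)"
    have e: "0 < e" "e < 1" "e < d1" "e < d2" using d1(1) d2(1) by (auto simp: e_def min_def)
    have "dist ((1 - e) *\<^sub>R x) x = e" "(1 - e) *\<^sub>R x \<in> cball 0 1" "x \<in> cball 0 1"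
      if "x \<in> sphere 0 1" for x :: 'a
    proof -
      have "(1 - e) *\<^sub>R x - x = - (e *\<^sub>R x)" by (simp add: algebra_simps)
      then show "dist ((1 - e) *\<^sub>R x) x = e" using that e by (simp add: dist_norm)
      show "(1 - e) *\<^sub>R x \<in> cball 0 1" "x \<in> cball 0 1"
        using that e by (simp_all only: mem_cball_0 norm_scaleR mem_sphere_0) auto
    qed
    then show thesis
      using e d1(2) d2(2) T by (intro that[of "1 - e"]) (auto simp: dist_norm)
  qed
  have sub: "norm x < 1" if "x \<in> cball 0 r" for x :: 'a using that r by auto
  obtain b :: 'a where "b \<in> Basis" using nonempty_Basis by blast
  then have b: "b \<in> sphere 0 1" by simp
  obtain t0 where t0: "t0^3 - 3 * w (r *\<^sub>R b) * t0 - 2 * z (r *\<^sub>R b) = 0" "norm (t0 - 2 * T b) < 1/4"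
    using cubic_root_near_double[of "T b" "z (r *\<^sub>R b)" "w (r *\<^sub>R b)"] near[OF b] T[OF b] by auto
  define C where "C = {(w::complex, t::complex). t^2 \<noteq> w \<and> t^2 \<noteq> 4*w}"
  define S where "S = {(z::complex, w::complex). z^2 \<noteq> w^3}"
  have cov: "covering_space C cubic_root_map S"
    unfolding C_def S_def by (rule covering_space_cubic_root_map)
  have feq: "(z (r *\<^sub>R b), w (r *\<^sub>R b)) = cubic_root_map (w (r *\<^sub>R b), t0)"
    using t0(1) by (simp add: cubic_root_map_def field_simps)
  have zwS: "(z x, w x) \<in> S" if "x \<in> cball 0 r" for x
    using int[OF sub[OF that]] by (simp add: S_def)
  have rb: "r *\<^sub>R b \<in> cball 0 r" using b r by simp
  have t0C: "(w (r *\<^sub>R b), t0) \<in> C"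
  proof -
    have "4 * (((t0^3 - 3*u*t0) / 2)^2 - u^3) = (t0^2 - u)^2 * (t0^2 - 4*u)" for u
      by (simp add: field_simps) algebra
    from this[of "w (r *\<^sub>R b)"] show ?thesis
      using zwS[OF rb] feq by (auto simp: C_def S_def cubic_root_map_def)
  qed
  \<comment> \<open>Lifting \<open>(z, w)\<close> through the covering selects a continuous root
    over the whole smaller ball, starting from \<open>t0\<close>.\<close>
  obtain g where g: "continuous_on (cball 0 r) g" "g \<in> cball 0 r \<rightarrow> C" "g (r *\<^sub>R b) = (w (r *\<^sub>R b), t0)"
    "\<And>y. y \<in> cball 0 r \<Longrightarrow> cubic_root_map (g y) = (z y, w y)"
    by (rule covering_space_lift_strong[OF cov t0C rb, of "\<lambda>x. (z x, w x)"])
       (use sub zwS feq in \<open>auto intro!: convex_imp_simply_connected convex_imp_locally_path_connected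
          continuous_on_Pair continuous_on_subset[OF z] continuous_on_subset[OF w] simp: less_imp_le\<close>)
  define t where "t x = snd (g x)" for x
  have t: "continuous_on (cball 0 r) t" unfolding t_def by (intro continuous_intros g)
  have gt: "g x = (w x, t x)" "t x ^ 3 - 3 * w x * t x - 2 * z x = 0" "t x ^ 2 - w x \<noteq> 0" if "x \<in> cball 0 r" for x
    using g(4)[OF that] funcset_mem[OF g(2) that]
    by (auto simp: cubic_root_map_def t_def C_def case_prod_unfold prod_eq_iff)
  have tb: "norm (t (r *\<^sub>R b) - 2 * T b) < 1/4" using g(3) t0 by (simp add: t_def)
  have rx: "r *\<^sub>R x \<in> cball 0 r" if "x \<in> sphere 0 1" for x :: 'a using that r by simp
  have conn: "connected (sphere 0 1 :: 'a set)" using dim by (intro connected_sphere) auto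
  have contr: "continuous_on (sphere 0 1) (\<lambda>x. f (r *\<^sub>R x))" if "continuous_on (cball 0 r) f" for f :: "'a \<Rightarrow> complex"
    by (rule continuous_on_compose2[OF that]) (use rx in \<open>auto intro: continuous_intros\<close>)
  \<comment> \<open>The points \<open>2 * T x\<close> and \<open>- T x\<close> are 3 apart. If the
    root, near the first at \<open>b\<close>, were not near it everywhere, its distance would equal
    1/4 at some \<open>y\<close> by connectedness, and there neither alternative of the dichotomy
    holds.\<close>
  have near2: "norm (t (r *\<^sub>R x) - 2 * T x) < 1/4" if "x \<in> sphere 0 1" for x
  proof (rule ccontr)
    assume not: "\<not> ?thesis"
    let ?p = "\<lambda>x. norm (t (r *\<^sub>R x) - 2 * T x)"
    let ?q = "\<lambda>x. norm (t (r *\<^sub>R x) + T x)"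
    have pq: "?p y < 1/4 \<or> ?q y < 1/4" if "y \<in> sphere 0 1" for y
      using cubic_root_dichotomy[OF gt(2)[OF rx[OF that]] T(3)[OF that]] near[OF that] by blast
    have npq: "3 \<le> ?p y + ?q y" if "y \<in> sphere 0 1" for y
      using norm_triangle_ineq4[of "t (r *\<^sub>R y) + T y" "t (r *\<^sub>R y) - 2 * T y"] T(3)[OF that]
      by (simp add: norm_mult)
    have "connected ((\<lambda>x. ?p x - 1/4) ` sphere 0 1)"
      by (intro connected_continuous_image conn continuous_intros contr[OF t] contT)
    then have "0 \<in> (\<lambda>x. ?p x - 1/4) ` sphere 0 1"
      by (rule connectedD_interval[of _ "?p b - 1/4" "?p x - 1/4" 0]) (use b that tb not in auto)
    then obtain y where "y \<in> sphere 0 1" "?p y = 1/4" by auto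
    then show False using pq[of y] npq[of y] by auto
  qed
  \<comment> \<open>This is a third of the derivative of the cubic at the root \<open>t\<close>; it
    has no zero because the root is simple, so it has a logarithm on the ball.\<close>
  obtain l where l: "continuous_on (cball 0 r) l" "\<And>x. x \<in> cball 0 r \<Longrightarrow> t x ^ 2 - w x = exp (l x)"
    by (rule continuous_logarithm_on_cball[of 0 r "\<lambda>x. t x ^ 2 - w x"])
       (use gt sub in \<open>auto intro!: continuous_intros t continuous_on_subset[OF w] simp: less_imp_le\<close>)
  \<comment> \<open>Close to \<open>(4 * T x ^ 2 - T x ^ 2) / T x ^ 2\<close>, which is 3. The
    estimate \<open>norm (k x - 3) < 3\<close> keeps \<open>k\<close> in the right half-plane, where
    \<open>Ln\<close> is continuous.\<close>
  define k where "k x = (t (r *\<^sub>R x) ^ 2 - w (r *\<^sub>R x)) / w x" for x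
  have k: "Re (k x) > 0" if x: "x \<in> sphere 0 1" for x
  proof -
    have "norm (t (r *\<^sub>R x) + 2 * T x) \<le> norm (t (r *\<^sub>R x) - 2 * T x) + norm (4 * T x)"
      using norm_triangle_ineq[of "t (r *\<^sub>R x) - 2 * T x" "4 * T x"] by (simp add: add.commute)
    then have "norm (t (r *\<^sub>R x) + 2 * T x) \<le> 5" using near2[OF x] T(3)[OF x] by (simp add: norm_mult)
    then have 1: "norm (t (r *\<^sub>R x) - 2 * T x) * norm (t (r *\<^sub>R x) + 2 * T x) \<le> 1/4 * 5"
      using near2[OF x] by (intro mult_mono) auto
    have "t (r *\<^sub>R x)^2 - w (r *\<^sub>R x) - 3 * w x =
      (t (r *\<^sub>R x) - 2 * T x) * (t (r *\<^sub>R x) + 2 * T x) - (w (r *\<^sub>R x) - T x ^ 2)"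
      unfolding T(1)[OF x, symmetric] by algebra
    also have "norm \<dots> \<le> 1/4 * 5 + 1/1000"
      using 1 near[OF x] by (intro order_trans[OF norm_triangle_ineq4 add_mono]) (auto simp: norm_mult)
    finally have "norm (t (r *\<^sub>R x)^2 - w (r *\<^sub>R x) - 3 * w x) < 3" by simp
    moreover have "k x - 3 = (t (r *\<^sub>R x)^2 - w (r *\<^sub>R x) - 3 * w x) / w x"
      using wnz[OF x] by (simp add: k_def diff_divide_distrib)
    ultimately have "norm (k x - 3) < 3"
      using bdry[of x] x by (simp add: norm_divide)
    then show ?thesis using abs_Re_le_cmod[of "k x - 3"] by simp
  qed
  \<comment> \<open>\<open>exp (l (r *\<^sub>R x)) / k x\<close> is \<open>w x\<close>, that is
    \<open>T x ^ 2\<close>, so half the difference of the logarithms is a logarithm of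
    \<open>T\<close> up to sign.\<close>
  define m where "m x = (l (r *\<^sub>R x) - Ln (k x)) / 2" for x
  have contk: "continuous_on (sphere 0 1) k"
    unfolding k_def using wnz
    by (intro continuous_intros contr t continuous_on_subset[OF w]) (auto simp: sub less_imp_le)
  have knz: "k x \<noteq> 0" "k x \<notin> \<real>\<^sub>\<le>\<^sub>0" if "x \<in> sphere 0 1" for x
    using k[OF that] by (auto simp: complex_nonpos_Reals_iff)
  have m: "continuous_on (sphere 0 1) m"
    unfolding m_def using knz by (intro continuous_intros contr l contk) auto
  have mT: "exp (m x) ^ 2 = T x ^ 2" if x: "x \<in> sphere 0 1" for x
  proof -
    have "exp (m x) ^ 2 = exp (l (r *\<^sub>R x)) / exp (Ln (k x))"
      by (simp only: m_def exp_diff exp_double[symmetric] times_divide_eq_right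
          nonzero_mult_div_cancel_left[of 2] zero_neq_numeral[symmetric] not_False_eq_True)
    also have "\<dots> = w x"
      using knz[OF x] wnz[OF x] l(2)[OF rx[OF x], symmetric] gt(3)[OF rx[OF x]] by (simp add: k_def)
    finally show ?thesis using T[OF x] by simp
  qed
  \<comment> \<open>The sign is continuous on the connected sphere, hence constant; it becomes the
    factor \<open>c\<close>.\<close>
  have "(\<lambda>x. T x / exp (m x)) constant_on sphere 0 1"
  proof (rule continuous_finite_range_constant[OF conn])
    show "continuous_on (sphere 0 1) (\<lambda>x. T x / exp (m x))"
      by (intro continuous_intros contT m) auto
    have "(\<lambda>x. T x / exp (m x)) ` sphere 0 1 \<subseteq> {1, -1}"
    proof safe
      fix x :: 'a assume x: "x \<in> sphere 0 1" and "T x / exp (m x) \<noteq> 1"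
      moreover have "T x = exp (m x) \<or> T x = - exp (m x)"
        using mT[OF x] power2_eq_iff by metis
      ultimately show "T x / exp (m x) = - 1" by auto
    qed
    then show "finite ((\<lambda>x. T x / exp (m x)) ` sphere 0 1)" by (rule finite_subset) simp
  qed
  then obtain c where "\<And>x. x \<in> sphere 0 1 \<Longrightarrow> T x / exp (m x) = c"
    unfolding constant_on_def by blast
  then have "T x = c * exp (m x)" if "x \<in> sphere 0 1" for x
    using that by (metis exp_not_eq_zero nonzero_divide_eq_eq)
  then show False
    using sphere_no_injective_logarithm[OF dim m _ injT, of c] T(3) by blast
qed

section \<open>The trefoil as a simple closed curve on the torus\<close>

text \<open>
  The maximum makes \<open>w\<close> continuous on the axis.  It adds no points to the curve: where the distance \<open>\<rho>\<close> to
  the axis is less than \<open>1\<close>, we have \<open>\<bar>w\<bar> = \<rho> < 1 < \<bar>z\<bar>\<close>.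
\<close>

definition trefoil :: "(real^3) set" where
  "trefoil = {x. meridian x ^ 2 = (planar x / of_real (max 1 (radial x))) ^ 3}"

lemma trefoil_norm:
  assumes "x \<in> trefoil"
  shows "norm (planar x / of_real (max 1 (radial x))) = 1" "norm (meridian x) = 1"
proof -
  define n where "n = norm (planar x / of_real (max 1 (radial x)))"
  have n: "n = radial x / max 1 (radial x)" by (simp add: n_def norm_divide radial_def)
  have "meridian x ^ 2 = (planar x / of_real (max 1 (radial x))) ^ 3" using assms by (simp add: trefoil_def)
  then have eq: "norm (meridian x) ^ 2 = n ^ 3" unfolding n_def by (metis norm_power)
  have "1 \<le> radial x"
  proof (rule ccontr)
    assume r: "\<not> 1 \<le> radial x"
    then have "n = radial x" by (simp add: n)
    moreover have "0 \<le> radial x" by (simp add: radial_def)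
    ultimately have "n ^ 3 \<le> 1" using r by (simp add: power_le_one)
    moreover have "1 < (2 - radial x) ^ 2" using r power_strict_mono[of 1 "2 - radial x" 2] by simp
    then have "1 < norm (meridian x) ^ 2"
      using zero_le_power2[of "x $ 3"] unfolding norm_meridian_squared power2_commute[of "radial x"] by linarith
    ultimately show False using eq by linarith
  qed
  then have "n = 1" by (simp add: n)
  then show "norm (planar x / of_real (max 1 (radial x))) = 1" by (simp add: n_def)
  show "norm (meridian x) = 1" using eq \<open>n = 1\<close> by (simp add: power2_eq_1_iff) (metis norm_ge_zero neg_0_le_iff_le not_one_le_zero)
qed

text \<open>The (2,3) torus knot: the direction about the axis turns twice while the cross-section
  turns three times. Conversely \<tau> is the quotient \<open>z / w\<close>, since
  \<open>z^2 = w^3\<close> gives \<open>(z / w)^2 = w\<close> and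
  \<open>(z / w)^3 = z\<close>.\<close>

lemma trefoil_altdef: "trefoil = (\<lambda>\<tau>. torus_point (\<tau> ^ 2) (\<tau> ^ 3)) ` sphere 0 1"
proof (intro equalityI subsetI)
  fix x assume x: "x \<in> trefoil"
  define w where "w = planar x / of_real (max 1 (radial x))"
  have n: "norm w = 1" "norm (meridian x) = 1" using trefoil_norm[OF x] by (simp_all add: w_def)
  have r: "1 \<le> radial x" using n by (intro one_le_radial) simp
  have eq: "meridian x ^ 2 = w ^ 3" using x by (simp add: trefoil_def w_def)
  have w0: "w \<noteq> 0" using n by auto
  define \<tau> where "\<tau> = meridian x / w"
  have "norm \<tau> = 1" using n by (simp add: \<tau>_def norm_divide)
  moreover have 2: "\<tau> ^ 2 = w"
  proof -
    have "\<tau> ^ 2 = w ^ 3 / w ^ 2" by (simp only: \<tau>_def power_divide eq)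
    then show ?thesis using w0 by (simp add: power2_eq_square power3_eq_cube)
  qed
  have "\<tau> ^ 3 = \<tau> ^ 2 * \<tau>" by (simp add: power2_eq_square power3_eq_cube)
  then have "\<tau> ^ 3 = meridian x" using w0 unfolding 2 by (simp add: \<tau>_def)
  moreover have "torus_point w (meridian x) = x"
    using r torus_point_sgn_meridian[of x] by (simp add: w_def max_def)
  ultimately show "x \<in> (\<lambda>\<tau>. torus_point (\<tau> ^ 2) (\<tau> ^ 3)) ` sphere 0 1"
    using 2 by (intro image_eqI[of _ _ \<tau>]) auto
next
  fix x assume "x \<in> (\<lambda>\<tau>. torus_point (\<tau> ^ 2) (\<tau> ^ 3)) ` sphere 0 1"
  then obtain \<tau> where t: "norm \<tau> = 1" "x = torus_point (\<tau> ^ 2) (\<tau> ^ 3)" by auto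
  have re: "-1 \<le> Re (\<tau> ^ 3)" using abs_Re_le_cmod[of "\<tau> ^ 3"] t by (simp add: norm_power)
  have "radial x = 2 + Re (\<tau> ^ 3)" "meridian x = \<tau> ^ 3"
    unfolding t(2) using re t(1) by (auto intro!: radial_torus_point meridian_torus_point simp: norm_power)
  moreover have "planar x = of_real (2 + Re (\<tau> ^ 3)) * \<tau> ^ 2" unfolding t(2) by (rule planar_torus_point)
  moreover have "max 1 (2 + Re (\<tau> ^ 3)) = 2 + Re (\<tau> ^ 3)" "complex_of_real (2 + Re (\<tau> ^ 3)) \<noteq> 0"
    using re by (auto simp del: of_real_add)
  ultimately show "x \<in> trefoil"
    by (simp add: trefoil_def power_mult[symmetric] del: of_real_add)
qed

lemma inj_on_trefoil_param: "inj_on (\<lambda>\<tau>. torus_point (\<tau> ^ 2) (\<tau> ^ 3)) (sphere 0 1)"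
proof (rule inj_on_inverseI)
  fix \<tau> :: complex assume "\<tau> \<in> sphere 0 1"
  then have t: "norm \<tau> = 1" by simp
  let ?x = "torus_point (\<tau> ^ 2) (\<tau> ^ 3)"
  have re: "-1 \<le> Re (\<tau> ^ 3)" using abs_Re_le_cmod[of "\<tau> ^ 3"] t by (simp add: norm_power)
  have "radial ?x = 2 + Re (\<tau> ^ 3)" "meridian ?x = \<tau> ^ 3"
    using re t by (auto intro!: radial_torus_point meridian_torus_point simp: norm_power)
  moreover have "complex_of_real (2 + Re (\<tau> ^ 3)) \<noteq> 0" "\<tau> \<noteq> 0" using re t by (auto simp del: of_real_add)
  \<comment> \<open>\<tau> is recovered as \<open>\<tau>^3 / \<tau>^2\<close>, the cross-section
    coordinate over the direction.\<close>
  ultimately show "(\<lambda>x. meridian x / (planar x / of_real (radial x))) ?x = \<tau>"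
    by (simp add: planar_torus_point power2_eq_square power3_eq_cube del: of_real_add)
qed

lemma simple_closed_curve_trefoil: "simple_closed_curve trefoil"
proof -
  define f where "f = (\<lambda>\<tau>. torus_point (\<tau> ^ 2) (\<tau> ^ 3))"
  define c where "c t = cis (2 * pi * t)" for t
  have "simple_path c"
    unfolding simple_path_def loop_free_def
  proof (intro conjI ballI impI)
    show "path c" unfolding path_def c_def by (intro continuous_intros)
    fix x y :: real assume xy: "x \<in> {0..1}" "y \<in> {0..1}" "c x = c y"
    then obtain n :: int where "2 * pi * x = 2 * pi * y + 2 * pi * of_int n"
      using sin_cos_eq_iff[of "2 * pi * x" "2 * pi * y"] by (auto simp: c_def complex_eq_iff)
    then have "2 * pi * x = 2 * pi * (y + of_int n)" by (simp only: distrib_left)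
    then have n: "x = y + of_int n" by simp
    then have "-1 \<le> n" "n \<le> 1" using xy by auto
    then have "n = -1 \<or> n = 0 \<or> n = 1" by linarith
    then show "x = y \<or> x = 0 \<and> y = 1 \<or> x = 1 \<and> y = 0" using n xy by auto
  qed
  moreover have image: "path_image c = sphere 0 1"
  proof (intro equalityI subsetI)
    fix z :: complex assume "z \<in> sphere 0 1"
    then have "cis (Arg2pi z) = z" by (simp add: complex_norm_eq_1_exp cis_conv_exp)
    then have "z = c (Arg2pi z / (2 * pi))" by (simp add: c_def)
    moreover have "Arg2pi z / (2 * pi) \<in> {0..1}" using Arg2pi[of z] by auto
    ultimately show "z \<in> path_image c" unfolding path_image_def by blast
  qed (auto simp: path_image_def c_def)
  ultimately have "simple_path (f \<circ> c)"
    using inj_on_trefoil_param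
    by (intro simple_path_continuous_image) (auto simp: f_def intro!: continuous_intros)
  moreover have "pathfinish (f \<circ> c) = pathstart (f \<circ> c)"
    by (simp add: pathfinish_def pathstart_def c_def)
  moreover have "path_image (f \<circ> c) = trefoil"
    by (simp add: path_image_compose image trefoil_altdef f_def)
  ultimately show ?thesis unfolding simple_closed_curve_def by blast
qed

text \<open>Injectivity keeps the open disk off the trefoil, that is \<open>z^2 \<noteq> w^3\<close>
  inside. On the boundary circle the pair \<open>(z, w)\<close> still determines the point of space,
  because the distance to the axis is at least 1 there and equals the maximum.\<close>

lemma trefoil_bounds_no_embedded_disk:
  assumes D: "embedded_disk D" "D ` sphere 0 1 = trefoil"
  shows False
proof -
  have emb: "continuous_on (cball 0 1) D" "inj_on D (cball 0 1)"
    using D(1) homeomorphic_imp_continuous_map homeomorphic_imp_injective_map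
    unfolding embedded_disk_def embedding_map_def by (fastforce simp: continuous_map_in_subtopology)+
  let ?w = "\<lambda>q. planar (D q) / of_real (max 1 (radial (D q)))"
  have sphere: "D q \<in> trefoil \<longleftrightarrow> norm q = 1" if "norm q \<le> 1" for q
  proof
    assume "D q \<in> trefoil"
    then obtain q' where "q' \<in> sphere 0 1" "D q = D q'" using D(2) by blast
    then show "norm q = 1" using inj_onD[OF emb(2), of q q'] that by auto
  next
    assume "norm q = 1"
    then show "D q \<in> trefoil" using D(2) by force
  qed
  show False
  proof (rule no_disk_spans_cuspidal_curve[of "\<lambda>q. meridian (D q)" ?w])
    show "continuous_on (cball 0 1) (\<lambda>q. meridian (D q))" "continuous_on (cball 0 1) ?w"
      using emb(1) by (auto intro!: continuous_intros)
    show "meridian (D q) ^ 2 = ?w q ^ 3 \<and> norm (?w q) = 1" if "norm q = 1" for q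
      using sphere[of q] that trefoil_norm[of "D q"] by (auto simp: trefoil_def)
    show "meridian (D q) ^ 2 \<noteq> ?w q ^ 3" if "norm q < 1" for q
      using sphere[of q] that by (auto simp: trefoil_def)
    show "inj_on (\<lambda>q. (meridian (D q), ?w q)) (sphere 0 1)"
    proof (rule inj_onI)
      fix p q :: "real^2" assume pq: "p \<in> sphere 0 1" "q \<in> sphere 0 1"
        and eq: "(meridian (D p), ?w p) = (meridian (D q), ?w q)"
      have *: "torus_point (?w x) (meridian (D x)) = D x" if "x \<in> sphere 0 1" for x
      proof -
        have "1 \<le> radial (D x)"
          using sphere[of x] that trefoil_norm[of "D x"] by (intro one_le_radial) simp
        then show ?thesis using torus_point_sgn_meridian[of "D x"] by (simp add: max_def)
      qed
      have eqs: "meridian (D p) = meridian (D q)" "?w p = ?w q"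
        using eq by (simp_all only: prod.inject)
      have "D p = torus_point (?w p) (meridian (D p))" using *[OF pq(1)] by (rule sym)
      also have "\<dots> = torus_point (?w q) (meridian (D q))" by (simp only: eqs)
      also have "\<dots> = D q" by (rule *[OF pq(2)])
      finally have "D p = D q" .
      then show "p = q" using inj_onD[OF emb(2), of p q] pq by auto
    qed
  qed simp
qed

theorem mainTheorem1:
  shows "\<exists>(M :: (real^3) set) \<Gamma>.
           mean_convex_domain M \<and> simple_closed_curve \<Gamma> \<and> \<Gamma> \<subseteq> frontier M \<and>
           (\<forall>D. area_minimizing_disk \<Gamma> D \<longrightarrow> \<not> embedded_disk D)"
proof (intro exI conjI allI impI notI)
  show "mean_convex_domain solid_torus" by (rule mean_convex_solid_torus)
  show "simple_closed_curve trefoil" by (rule simple_closed_curve_trefoil)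
  show "trefoil \<subseteq> frontier solid_torus" using trefoil_norm(2) by (auto simp: frontier_solid_torus)
  fix D assume "area_minimizing_disk trefoil D" "embedded_disk D"
  then show False
    using trefoil_bounds_no_embedded_disk
    by (auto simp: area_minimizing_disk_def disk_spanning_def)
qed

end
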